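(* The Ehrhart polynomial of $\mathrm{Conv}(A_{127})$ has a complex root whose real part is greater than $\dim(\mathrm{Conv}(A_{127})) = 126$. As a result, $\mathrm{Conv}(A_{127})$ is a smooth Fano polytope that is a counterexample to both of the following two assertions: (i) for every lattice polytope of dimension $D$, all roots $\alpha \in \mathbb{C}$ of its Ehrhart polynomial satisfy $-D \le \mathrm{Re}(\alpha) \le D-1$; (ii) for every Gorenstein Fano polytope of dimension $D$, all roots $\alpha \in \mathbb{C}$ of its Ehrhart polynomial satisfy $-D/2 \le \mathrm{Re}(\alpha) \le D/2 - 1$.
   Context: For an integer $d \ge 3$, let $e_1,\dots,e_{d+1}$ be the standard basis of $\mathbb{R}^{d+1}$. $A_d$ is the $(d+1)\times(2d+1)$ integer matrix whose columns are: $e_{d+1}$; the vectors $e_i - e_{i+1} + e_{d+1}$ for $1\le i\le d-1$ and $e_d - e_1 + e_{d+1}$; and the vectors $-e_i + e_{i+1} + e_{d+1}$ for $1 \le i \le d-1$ and $-e_d + e_1 + e_{d+1}$. $\mathrm{Conv}(A_d) \subset \mathbb{R}^{d+1}$ is the convex hull of the columns of $A_d$ (the symmetric edge polytope of the cycle of length $d$). The Ehrhart polynomial of a lattice polytope $P \subset \mathbb{R}^N$ is the polynomial $L_P$ with $L_P(m) = |mP \cap \mathbb{Z}^{N}|$ for all integers $m \ge 1$; its roots are taken in $\mathbb{C}$. Fano terminology is understood after translating $\mathrm{Conv}(A_d)$ by $-e_{d+1}$, so that it lies in the linear space $\{x \in \mathbb{R}^{d}: x_1+\cdots+x_d = 0\}$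 (identified with a subspace of $\mathbb{R}^{d+1}$) with lattice $\{x\in\mathbb{Z}^d : x_1 + \cdots + x_d = 0\}$. A full-dimensional lattice polytope, with respect to a given lattice, is Gorenstein Fano (reflexive) if the origin is in its interior and its dual polytope is also a lattice polytope with respect to the dual lattice; it is smooth Fano if the origin is in its interior and the vertices of each facet form a $\mathbb{Z}$-basis of the lattice. (A smooth Fano polytope is Gorenstein Fano.) *)

theory Defs
  imports "HOL-Analysis.Analysis" "HOL-Computational_Algebra.Polynomial"
begin

section \<open>Lattices and lattice polytopes\<close>

definition int_lattice :: "(real^'n) set" where
  "int_lattice = {x. \<forall>i. x $ i \<in> \<int>}"

definition int_span :: "'a::real_vector set \<Rightarrow> 'a set" where
  "int_span B = range (\<lambda>c :: 'a \<Rightarrow> int. \<Sum>b\<in>B. of_int (c b) *\<^sub>R b)"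

definition is_lattice :: "'a::euclidean_space set \<Rightarrow> bool" where
  "is_lattice L \<longleftrightarrow> (\<exists>B. finite B \<and> independent B \<and> L = int_span B)"

definition is_int_basis :: "'a::real_vector set \<Rightarrow> 'a set \<Rightarrow> bool" where
  "is_int_basis L B \<longleftrightarrow> finite B \<and> L = int_span B \<and>
     (\<forall>c :: 'a \<Rightarrow> int. (\<Sum>b\<in>B. of_int (c b) *\<^sub>R b) = 0 \<longrightarrow> (\<forall>b\<in>B. c b = 0))"

definition lattice_polytope :: "'a::real_vector set \<Rightarrow> 'a set \<Rightarrow> bool" where
  "lattice_polytope L P \<longleftrightarrow>
     (\<exists>V. finite V \<and> V \<noteq> {} \<and> V \<subseteq> L \<and> P = convex hull V)"

section \<open>Ehrhart polynomials\<close>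

definition is_ehrhart_poly :: "(real^'n) set \<Rightarrow> complex poly \<Rightarrow> bool" where
  "is_ehrhart_poly P p \<longleftrightarrow>
     (\<forall>m::nat. m \<ge> 1 \<longrightarrow>
        poly p (of_nat m) = of_nat (card ((\<lambda>x. real m *\<^sub>R x) ` P \<inter> int_lattice)))"

lemma is_ehrhart_poly_unique:
  assumes "is_ehrhart_poly P p" "is_ehrhart_poly P q"
  shows "p = q"
proof (rule ccontr)
  assume "p \<noteq> q"
  then have "finite {x. poly (p - q) x = 0}"
    by (intro poly_roots_finite) simp
  moreover have "(of_nat :: nat \<Rightarrow> complex) ` {1..} \<subseteq> {x. poly (p - q) x = 0}"
    using assms by (auto simp: is_ehrhart_poly_def)
  ultimately have "finite ((of_nat :: nat \<Rightarrow> complex) ` {1..})"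
    using finite_subset by blast
  then have "finite {1::nat..}"
    by (rule finite_imageD) (simp add: inj_on_def)
  then show False
    by (simp add: infinite_Ici)
qed

definition ehrhart_roots_in_strip :: "(real^'n) set \<Rightarrow> real \<Rightarrow> real \<Rightarrow> bool" where
  "ehrhart_roots_in_strip P a b \<longleftrightarrow>
     (\<forall>p \<alpha>. is_ehrhart_poly P p \<and> poly p \<alpha> = 0 \<longrightarrow> a \<le> Re \<alpha> \<and> Re \<alpha> \<le> b)"

section \<open>Fano polytopes with respect to a lattice\<close>

text \<open>
  The lattice need not have full rank in the ambient space: everything is relative to its real
  span, whose dual space is identified with the span itself via the inner product.
\<close>

definition full_dim_lattice_polytope :: "'a::euclidean_space set \<Rightarrow> 'a set \<Rightarrow> bool" where
  "full_dim_lattice_polytope L P \<longleftrightarrow>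
     is_lattice L \<and> lattice_polytope L P \<and> aff_dim P = int (dim (span L))"

definition origin_in_interior :: "'a::euclidean_space set \<Rightarrow> 'a set \<Rightarrow> bool" where
  "origin_in_interior L P \<longleftrightarrow> 0 \<in> (top_of_set (span L)) interior_of P"

definition dual_lattice :: "'a::euclidean_space set \<Rightarrow> 'a set" where
  "dual_lattice L = {y \<in> span L. \<forall>x\<in>L. x \<bullet> y \<in> \<int>}"

text \<open>
  The other common convention for the dual polytope, with \<open>x \<bullet> y \<ge> -1\<close>, yields the negative of
  the one below, so the choice does not affect being a lattice polytope.
\<close>

definition dual_polytope :: "'a::euclidean_space set \<Rightarrow> 'a set \<Rightarrow> 'a set" where
  "dual_polytope L P = {y \<in> span L. \<forall>x\<in>P. x \<bullet> y \<le> 1}"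

definition gorenstein_fano :: "'a::euclidean_space set \<Rightarrow> 'a set \<Rightarrow> bool" where
  "gorenstein_fano L P \<longleftrightarrow>
     full_dim_lattice_polytope L P \<and> origin_in_interior L P \<and>
     lattice_polytope (dual_lattice L) (dual_polytope L P)"

definition smooth_fano :: "'a::euclidean_space set \<Rightarrow> 'a set \<Rightarrow> bool" where
  "smooth_fano L P \<longleftrightarrow>
     full_dim_lattice_polytope L P \<and> origin_in_interior L P \<and>
     (\<forall>F. F facet_of P \<longrightarrow> is_int_basis L {v. v extreme_point_of F})"

section \<open>Symmetric edge polytopes of cycles\<close>

text \<open>
  Coordinates are numbered from 1, through the canonical enumeration of the index type.
  The constants below that take an argument \<open>d\<close> are meant to be used with
  \<open>CARD('n) = d + 1\<close> and \<open>d \<ge> 3\<close>.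
\<close>

definition coord :: "nat \<Rightarrow> 'n::enum" where
  "coord i = Enum.enum ! (i - 1)"

definition e :: "nat \<Rightarrow> real^'n::enum" where
  "e i = axis (coord i) 1"

definition A_columns :: "nat \<Rightarrow> (real^'n::enum) list" where
  "A_columns d =
     [e (d + 1)]
     @ map (\<lambda>i. e i - e (i + 1) + e (d + 1)) [1..<d] @ [e d - e 1 + e (d + 1)]
     @ map (\<lambda>i. - e i + e (i + 1) + e (d + 1)) [1..<d] @ [- e d + e 1 + e (d + 1)]"

definition conv_A :: "nat \<Rightarrow> (real^'n::enum) set" where
  "conv_A d = convex hull (set (A_columns d))"

definition conv_A_centered :: "nat \<Rightarrow> (real^'n::enum) set" where
  "conv_A_centered d = (\<lambda>x. x - e (d + 1)) ` conv_A d"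

definition sum_zero_lattice :: "nat \<Rightarrow> (real^'n::enum) set" where
  "sum_zero_lattice d =
     {x \<in> int_lattice. x $ coord (d + 1) = 0 \<and> (\<Sum>i = 1..d. x $ coord i) = 0}"

end

theory Submission
  imports Defs "HOL-Computational_Algebra.Fundamental_Theorem_Algebra"
begin

text \<open>
  The matrix has as columns, up to the common translation by the last basis vector, \<open>0\<close> and the
  signed edge vectors \<open>u i\<close> and \<open>- u i\<close> of an odd cycle of length \<open>d = 2 * k + 1\<close>. Their sum being
  \<open>0\<close> is the only relation between the \<open>u i\<close>, and all statements about the polytope are derived
  from this (locale \<open>odd_circuit\<close>).

  Geometry. A supporting functional of a facet takes values of absolute value at most its maximum
  on the \<open>u i\<close>, and these \<open>d\<close> values have sum \<open>0\<close>. As \<open>d\<close> is odd, they are not all extremal up to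
  sign, while the dimension of the facet forces all but one to be. Hence the vertices of a facet are
  \<open>d - 1\<close> signed edge vectors, which form a lattice basis (\<open>facet_int_basis\<close>): the polytope is smooth
  Fano. An extreme point of the dual polytope pairs to \<open>1\<close> or \<open>-1\<close> with all edge vectors but at most
  one, and to an integer with the last one because the pairings have sum \<open>0\<close>
  (\<open>dual_vertex_integral\<close>), so the polytope is Gorenstein Fano.

  Counting. A lattice point is a combination of the \<open>u i\<close> with integer coefficients, unique up to a
  common shift; it lies in the \<open>m\<close>-th dilate if and only if some shift makes the sum of their absolute
  values at most \<open>m\<close>. The best shift is by the median, which is unique and integral for odd \<open>d\<close>
  (\<open>card_dilated_body\<close>). Counting functions with median \<open>0\<close> by support and sign (\<open>card_balanced\<close>)
  gives the Ehrhart polynomial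
  \<open>\<Sum>j\<le>2 * k. (d choose j) * balanced_splits k j * (z gchoose j)\<close>.

  The root. If all roots had real part at most \<open>126\<close>, then the absolute value of the polynomial would
  not decrease along the horizontal ray to the right of any point with real part \<open>126\<close>
  (\<open>exists_root_Re_greater\<close>). For \<open>d = 127\<close> it does decrease from \<open>126 + 172 \<i>\<close> to
  \<open>126.5 + 172 \<i>\<close>. This is checked by exact integer arithmetic, with Horner's scheme scaled to
  Gaussian integers (\<open>horner_ehrhart_cycle\<close>, \<open>horner_values_drop_127\<close>).
\<close>

section \<open>Counting integer functions with median zero\<close>

lemma sum_choose_lessThan: "(\<Sum>w<m. w choose s) = m choose Suc s"
  by (induction m) auto

definition positive_bounded :: "'i set \<Rightarrow> nat \<Rightarrow> ('i \<Rightarrow> nat) set" where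
  "positive_bounded S m =
     {g. (\<forall>i\<in>S. 0 < g i) \<and> (\<forall>i. i \<notin> S \<longrightarrow> g i = 0) \<and> sum g S \<le> m}"

text \<open>
  Split off the value \<open>v\<close> at one point of \<open>S\<close>: the remaining values have sum at most \<open>m - v\<close>, and
  summing over \<open>v\<close> is the hockey-stick identity.
\<close>

lemma card_positive_bounded:
  assumes "finite S"
  shows "finite (positive_bounded S m) \<and> card (positive_bounded S m) = m choose card S"
  using assms
proof (induction S arbitrary: m rule: finite_induct)
  case empty
  have "positive_bounded {} m = {\<lambda>i::'a. 0}"
    by (auto simp: positive_bounded_def)
  then show ?case by simp
next
  case (insert x S)
  let ?P = "Sigma {1..m} (\<lambda>v. positive_bounded S (m - v))"
  have "bij_betw (\<lambda>(v, g). g(x := v)) ?P (positive_bounded (insert x S) m)"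
  proof (rule bij_betwI[where g = "\<lambda>g. (g x, g(x := 0))"])
    show "(\<lambda>(v, g). g(x := v)) \<in> ?P \<rightarrow> positive_bounded (insert x S) m"
    proof
      fix p assume "p \<in> ?P"
      then obtain v g where p: "p = (v, g)" and v: "1 \<le> v" "v \<le> m"
        and g: "\<forall>i\<in>S. 0 < g i" "\<forall>i. i \<notin> S \<longrightarrow> g i = 0" "sum g S \<le> m - v"
        by (auto simp: positive_bounded_def)
      have "sum (g(x := v)) S = sum g S"
        using insert.hyps by (intro sum.cong) auto
      then have "sum (g(x := v)) (insert x S) \<le> m"
        using g v insert.hyps by (simp del: fun_upd_apply add: fun_upd_same)
      then show "(\<lambda>(v, g). g(x := v)) p \<in> positive_bounded (insert x S) m"
        using g v by (auto simp: p positive_bounded_def)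
    qed
  next
    show "(\<lambda>g. (g x, g(x := 0))) \<in> positive_bounded (insert x S) m \<rightarrow> ?P"
    proof
      fix g assume "g \<in> positive_bounded (insert x S) m"
      then have g: "\<forall>i\<in>insert x S. 0 < g i" "\<forall>i. i \<notin> insert x S \<longrightarrow> g i = 0"
        "sum g (insert x S) \<le> m"
        by (auto simp: positive_bounded_def)
      have s: "sum (g(x := 0)) S = sum g S"
        using insert.hyps by (intro sum.cong) auto
      show "(g x, g(x := 0)) \<in> ?P"
        using g s insert.hyps by (auto simp: positive_bounded_def Suc_le_eq)
    qed
  next
    fix p assume "p \<in> ?P"
    then show "(\<lambda>g. (g x, g(x := 0))) ((\<lambda>(v, g). g(x := v)) p) = p"
      using insert.hyps by (auto simp: positive_bounded_def fun_eq_iff)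
  qed (auto simp: fun_eq_iff)
  then have *: "finite (positive_bounded (insert x S) m) = finite ?P"
    "card (positive_bounded (insert x S) m) = card ?P"
    by (auto dest: bij_betw_finite bij_betw_same_card)
  have fin: "finite ?P"
    using insert.IH by auto
  have "card ?P = (\<Sum>v\<in>{1..m}. (m - v) choose card S)"
    using insert.IH by simp
  also have "\<dots> = (\<Sum>w<m. w choose card S)"
    by (rule sum.reindex_bij_witness[where i = "\<lambda>w. m - w" and j = "\<lambda>v. m - v"]) auto
  finally have "card ?P = m choose Suc (card S)"
    by (simp add: sum_choose_lessThan)
  then show ?case
    using insert.hyps fin * by simp
qed

text \<open>
  The number of ways to give signs to \<open>s\<close> nonzero values so that each sign occurs at most \<open>k\<close>
  times. In the sum \<open>a\<close> is the number of positive signs; the terms with \<open>a > s\<close> vanish.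
\<close>

definition balanced_splits :: "nat \<Rightarrow> nat \<Rightarrow> nat" where
  "balanced_splits k s = (\<Sum>a = s - k..k. s choose a)"

lemma card_balanced_splits:
  assumes "finite S"
  shows "card {A \<in> Pow S. card A \<le> k \<and> card (S - A) \<le> k} = balanced_splits k (card S)"
proof -
  have "{A \<in> Pow S. card A \<le> k \<and> card (S - A) \<le> k}
      = (\<Union>a\<in>{card S - k..k}. {A. A \<subseteq> S \<and> card A = a})"
    using assms by (auto simp: card_Diff_subset finite_subset)
  also have "card \<dots> = (\<Sum>a\<in>{card S - k..k}. card {A. A \<subseteq> S \<and> card A = a})"
    using assms by (intro card_UN_disjoint) auto
  finally show ?thesis
    using assms by (simp add: n_subsets balanced_splits_def)
qed

lemma sum_Pow_card:
  fixes h :: "nat \<Rightarrow> nat"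
  assumes "finite X"
  shows "(\<Sum>S\<in>Pow X. h (card S)) = (\<Sum>j\<le>card X. (card X choose j) * h j)"
proof -
  have "(\<Sum>S\<in>Pow X. h (card S))
      = (\<Sum>j\<le>card X. \<Sum>S\<in>{S \<in> Pow X. card S = j}. h (card S))"
    using assms by (intro sum.group[symmetric]) (auto intro: card_mono)
  also have "\<dots> = (\<Sum>j\<le>card X. card {S. S \<subseteq> X \<and> card S = j} * h j)"
    by (intro sum.cong) auto
  finally show ?thesis
    using assms by (simp add: n_subsets)
qed

text \<open>
  For \<open>d = 2 * k + 1\<close> values this says that their median is \<open>0\<close>: at most \<open>k\<close> of them lie on
  either side of it.
\<close>

definition median_zero :: "nat \<Rightarrow> nat \<Rightarrow> (nat \<Rightarrow> int) \<Rightarrow> bool" where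
  "median_zero k d f \<longleftrightarrow>
     card {i. i < d \<and> 0 < f i} \<le> k \<and> card {i. i < d \<and> f i < 0} \<le> k"

definition balanced :: "nat \<Rightarrow> nat \<Rightarrow> nat \<Rightarrow> (nat \<Rightarrow> int) set" where
  "balanced k d m = {f. (\<forall>i\<ge>d. f i = 0) \<and> median_zero k d f \<and> (\<Sum>i<d. \<bar>f i\<bar>) \<le> int m}"

text \<open>
  A balanced function is given by its support, the set of points of the support where it is
  positive, and its absolute values there. The three choices are counted by the three factors.
\<close>

lemma card_balanced:
  "card (balanced k d m) = (\<Sum>j\<le>d. (d choose j) * balanced_splits k j * (m choose j))"
proof -
  let ?A = "\<lambda>S. {A \<in> Pow S. card A \<le> k \<and> card (S - A) \<le> k}"
  let ?P = "Sigma (Pow {..<d}) (\<lambda>S. ?A S \<times> positive_bounded S m)"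
  let ?F = "\<lambda>(S :: nat set, A, g) i. if i \<in> A then int (g i) else - int (g i)"
  let ?G = "\<lambda>f. ({i. i < d \<and> f i \<noteq> 0}, {i. i < d \<and> 0 < f i}, \<lambda>i. nat \<bar>f i\<bar>)"
  have "bij_betw ?F ?P (balanced k d m)"
  proof (rule bij_betwI[where g = ?G])
    show "?F \<in> ?P \<rightarrow> balanced k d m"
    proof
      fix p assume "p \<in> ?P"
      then obtain S A g where p: "p = (S, A, g)" and S: "S \<subseteq> {..<d}"
        and A: "A \<subseteq> S" "card A \<le> k" "card (S - A) \<le> k"
        and g: "g \<in> positive_bounded S m" by auto
      have "{i. i < d \<and> 0 < ?F (S, A, g) i} = A" "{i. i < d \<and> ?F (S, A, g) i < 0} = S - A"
        using S A g by (auto simp: positive_bounded_def subset_iff split: if_splits) 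
      moreover have "(\<Sum>i<d. \<bar>?F (S, A, g) i\<bar>) = int (sum g S)"
      proof -
        have "(\<Sum>i<d. \<bar>?F (S, A, g) i\<bar>) = (\<Sum>i<d. int (g i))"
          by (intro sum.cong) auto
        also have "\<dots> = (\<Sum>i\<in>S. int (g i))"
          using S g by (intro sum.mono_neutral_right) (auto simp: positive_bounded_def)
        finally show ?thesis by simp
      qed
      moreover have "int (sum g S) \<le> int m"
        using g by (simp add: positive_bounded_def del: of_nat_sum)
      ultimately show "?F p \<in> balanced k d m"
        using S A g unfolding p balanced_def median_zero_def by (auto simp: positive_bounded_def)
    qed
  next
    show "?G \<in> balanced k d m \<rightarrow> ?P"
    proof
      fix f assume f: "f \<in> balanced k d m"
      have "{i. i < d \<and> f i \<noteq> 0} - {i. i < d \<and> 0 < f i} = {i. i < d \<and> f i < 0}"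
        by auto
      moreover have "int (\<Sum>i | i < d \<and> f i \<noteq> 0. nat \<bar>f i\<bar>) = (\<Sum>i<d. \<bar>f i\<bar>)"
        unfolding of_nat_sum by (intro sum.mono_neutral_cong_left) auto
      then have "(\<Sum>i | i < d \<and> f i \<noteq> 0. nat \<bar>f i\<bar>) \<le> m"
        using f unfolding balanced_def by (simp del: of_nat_sum)
      ultimately show "?G f \<in> ?P"
        using f unfolding balanced_def median_zero_def positive_bounded_def by (auto simp: not_less)
    qed
  next
    fix p assume "p \<in> ?P"
    then obtain S A g where p: "p = (S, A, g)" and S: "S \<subseteq> {..<d}" and A: "A \<subseteq> S"
        and g: "g \<in> positive_bounded S m" by auto
    define f where "f = ?F p"
    have "{i. i < d \<and> f i \<noteq> 0} = S" "{i. i < d \<and> 0 < f i} = A" "(\<lambda>i. nat \<bar>f i\<bar>) = g"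
      using S A g by (auto simp: f_def p positive_bounded_def subset_iff split: if_splits)
    then have "?G f = p" by (simp only: p)
    then show "?G (?F p) = p" by (simp only: f_def)
  next
    fix f assume "f \<in> balanced k d m"
    then show "?F (?G f) = f"
      by (auto simp: balanced_def fun_eq_iff not_less)
  qed
  then have "card (balanced k d m) = card ?P"
    by (rule bij_betw_same_card[symmetric])
  also have "\<dots> = (\<Sum>S\<in>Pow {..<d}. balanced_splits k (card S) * (m choose card S))"
  proof -
    have fin: "finite S" if "S \<in> Pow {..<d}" for S :: "nat set"
      using that finite_subset by auto
    then have "\<forall>S\<in>Pow {..<d}. finite (?A S \<times> positive_bounded S m)"
      by (auto simp: card_positive_bounded)
    then have "card ?P = (\<Sum>S\<in>Pow {..<d}. card (?A S \<times> positive_bounded S m))"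
      by (intro card_SigmaI) auto
    also have "\<dots> = (\<Sum>S\<in>Pow {..<d}. balanced_splits k (card S) * (m choose card S))"
      using fin by (intro sum.cong)
        (simp_all only: card_cartesian_product card_balanced_splits card_positive_bounded)
    finally show ?thesis .
  qed
  also have "\<dots> = (\<Sum>j\<le>d. (d choose j) * (balanced_splits k j * (m choose j)))"
    using sum_Pow_card[of "{..<d}" "\<lambda>j. balanced_splits k j * (m choose j)"] by simp
  finally show ?thesis by (simp add: mult.assoc)
qed

lemma balanced_splits_0: "balanced_splits k 0 = 1"
proof -
  have "balanced_splits k 0 = (\<Sum>a\<in>{0}. 0 choose a)"
    unfolding balanced_splits_def by (intro sum.mono_neutral_right) auto
  then show ?thesis by simp
qed

text \<open>
  By Pascal's rule the sum over the window \<open>{j + 1 - k..k}\<close> of row \<open>j + 1\<close> is twice the window sum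
  of row \<open>j\<close>, except that each of the two copies loses one boundary term. By symmetry both lost
  terms are equal to \<open>j choose k\<close>.
\<close>

lemma balanced_splits_Suc:
  assumes "j \<le> 2 * k"
  shows "balanced_splits k (Suc j) + 2 * (j choose k) = 2 * balanced_splits k j"
proof (cases "j < k")
  case True
  have "balanced_splits k s = 2 ^ s" if "s \<le> k" for s
  proof -
    have "balanced_splits k s = (\<Sum>a\<le>s. s choose a)"
      using that unfolding balanced_splits_def by (intro sum.mono_neutral_right) auto
    then show ?thesis by (simp add: choose_row_sum)
  qed
  then show ?thesis using True by simp
next
  case False
  have "balanced_splits k (Suc j) = (\<Sum>a = Suc (j - k)..k. Suc j choose a)"
    using False by (simp add: balanced_splits_def Suc_diff_le)
  also have "\<dots> = (\<Sum>a = Suc (j - k)..k. (j choose a) + (j choose (a - 1)))"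
    by (intro sum.cong) (auto simp: choose_reduce_nat[of "Suc j"])
  also have "\<dots> = (\<Sum>a = Suc (j - k)..k. j choose a) + (\<Sum>a = j - k..<k. j choose a)"
    unfolding sum.distrib
    by (intro arg_cong2[where f = "(+)"] refl
          sum.reindex_bij_witness[where i = Suc and j = "\<lambda>a. a - 1"]) auto
  finally have "balanced_splits k (Suc j)
      = (\<Sum>a = Suc (j - k)..k. j choose a) + (\<Sum>a = j - k..<k. j choose a)" .
  moreover have "balanced_splits k j = (j choose k) + (\<Sum>a = Suc (j - k)..k. j choose a)"
    using assms False binomial_symmetric[of k j]
    by (simp add: balanced_splits_def sum.atLeast_Suc_atMost)
  moreover have "balanced_splits k j = (\<Sum>a = j - k..<k. j choose a) + (j choose k)"
    using assms by (simp add: balanced_splits_def sum.last_plus add.commute)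
  ultimately show ?thesis by simp
qed

section \<open>Medians of an odd number of integers\<close>

lemma median_zero_uminus: "median_zero k d f \<Longrightarrow> median_zero k d (\<lambda>i. - f i)"
  by (simp add: median_zero_def)

lemma median_zero_card_nonneg:
  assumes "d = 2 * k + 1" "median_zero k d f"
  shows "k < card {i. i < d \<and> 0 \<le> f i}"
proof -
  have "{i. i < d \<and> 0 \<le> f i} \<union> {i. i < d \<and> f i < 0} = {..<d}" by auto
  then have "d = card ({i. i < d \<and> 0 \<le> f i} \<union> {i. i < d \<and> f i < 0})" by simp
  also have "\<dots> = card {i. i < d \<and> 0 \<le> f i} + card {i. i < d \<and> f i < 0}"
    by (intro card_Un_disjoint) auto
  finally show ?thesis using assms by (simp add: median_zero_def)
qed

text \<open>
  The least value that is exceeded by at most \<open>k\<close> of the others is a median.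
\<close>

lemma median_exists:
  fixes c :: "nat \<Rightarrow> int"
  assumes d: "d = 2 * k + 1"
  obtains t where "median_zero k d (\<lambda>i. c i - t)"
proof -
  let ?X = "{t \<in> c ` {..<d}. card {i. i < d \<and> t < c i} \<le> k}"
  have ne: "c ` {..<d} \<noteq> {}" using d by auto
  have "{i. i < d \<and> Max (c ` {..<d}) < c i} = {}"
  proof -
    have "\<not> Max (c ` {..<d}) < c i" if "i < d" for i
      using that by (simp add: not_less)
    then show ?thesis by blast
  qed
  then have "Max (c ` {..<d}) \<in> ?X"
    using Max_in[OF _ ne] by (simp only: mem_Collect_eq card.empty) simp
  then have t: "Min ?X \<in> ?X" by (intro Min_in) auto
  define t where "t = Min ?X"
  have "card {i. i < d \<and> c i < t} \<le> k"
  proof (rule ccontr)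
    assume many: "\<not> card {i. i < d \<and> c i < t} \<le> k"
    let ?J = "{i. i < d \<and> c i < t}"
    have "?J \<noteq> {}"
    proof
      assume J: "?J = {}"
      show False using many unfolding J by simp
    qed
    then have t': "Max (c ` ?J) \<in> c ` ?J" by (intro Max_in) auto
    have "{i. i < d \<and> Max (c ` ?J) < c i} \<subseteq> {..<d} - ?J"
    proof -
      have "c i \<le> Max (c ` ?J)" if "i \<in> ?J" for i using that by (intro Max_ge) auto
      then show ?thesis by (auto simp: not_less[symmetric])
    qed
    then have "card {i. i < d \<and> Max (c ` ?J) < c i} \<le> card ({..<d} - ?J)"
      by (intro card_mono) auto
    also have "\<dots> = d - card ?J" by (subst card_Diff_subset) auto
    also have "\<dots> \<le> k" using many d by simp
    finally have "Max (c ` ?J) \<in> ?X" using t' by auto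
    then have "t \<le> Max (c ` ?J)" unfolding t_def by (intro Min_le) auto
    then show False using t' by auto
  qed
  then have "median_zero k d (\<lambda>i. c i - t)"
    using t by (simp add: median_zero_def flip: t_def)
  then show ?thesis by (rule that)
qed

text \<open>
  The median minimises the sum of distances: a shift by \<open>s \<ge> 0\<close> moves the at least \<open>k + 1\<close>
  nonnegative values away from \<open>0\<close> by \<open>s\<close>, and brings the at most \<open>k\<close> negative ones closer by at
  most \<open>s\<close>. The shift \<open>s\<close> is real although the values are integers, because the coefficients that
  witness membership in the polytope are only real.
\<close>

lemma median_zero_minimal:
  fixes s :: real
  assumes d: "d = 2 * k + 1" and f: "median_zero k d f"
  shows "(\<Sum>i<d. \<bar>of_int (f i)\<bar>) \<le> (\<Sum>i<d. \<bar>of_int (f i) + s\<bar>)"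
proof -
  have *: "(\<Sum>i<d. \<bar>of_int (f i)\<bar>) \<le> (\<Sum>i<d. \<bar>of_int (f i) + s\<bar>)"
    if f: "median_zero k d f" and s: "0 \<le> s" for f and s :: real
  proof -
    let ?A = "{i. i < d \<and> 0 \<le> f i}" and ?B = "{i. i < d \<and> f i < 0}"
    have "(\<Sum>i<d. if 0 \<le> f i then s else - s) = (\<Sum>i\<in>?A. s) + (\<Sum>i\<in>?B. - s)"
    proof -
      have "{..<d} \<inter> {i. 0 \<le> f i} = ?A" "{..<d} \<inter> - {i. 0 \<le> f i} = ?B" by auto
      then show ?thesis by (simp only: sum.If_cases[OF finite_lessThan])
    qed
    also have "\<dots> = s * (real (card ?A) - real (card ?B))"
      by (simp add: algebra_simps)
    also have "\<dots> \<ge> 0"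
      using s median_zero_card_nonneg[OF d f] f by (auto simp: median_zero_def)
    finally have "(\<Sum>i<d. \<bar>real_of_int (f i)\<bar>)
        \<le> (\<Sum>i<d. \<bar>real_of_int (f i)\<bar>) + (\<Sum>i<d. if 0 \<le> f i then s else - s)" by simp
    also have "\<dots> \<le> (\<Sum>i<d. \<bar>of_int (f i) + s\<bar>)"
      unfolding sum.distrib[symmetric] using s by (intro sum_mono) auto
    finally show ?thesis .
  qed
  show ?thesis
  proof (cases "0 \<le> s")
    case True
    with * f show ?thesis by blast
  next
    case False
    then have "(\<Sum>i<d. \<bar>real_of_int (- f i)\<bar>) \<le> (\<Sum>i<d. \<bar>real_of_int (- f i) + - s\<bar>)"
      using f by (intro * median_zero_uminus) auto
    also have "\<dots> = (\<Sum>i<d. \<bar>of_int (f i) + s\<bar>)"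
      by (intro sum.cong) auto
    finally show ?thesis by simp
  qed
qed

text \<open>
  Applied in both directions, this says that the median of an odd number of values is unique. It
  fails for an even number of values.
\<close>

lemma median_zero_shift_unique:
  assumes d: "d = 2 * k + 1" and f: "median_zero k d f" and f': "median_zero k d f'"
    and eq: "\<And>i. i < d \<Longrightarrow> f' i = f i + t"
  shows "t \<le> 0"
proof (rule ccontr)
  assume "\<not> t \<le> 0"
  then have "{i. i < d \<and> 0 \<le> f i} \<subseteq> {i. i < d \<and> 0 < f' i}" by (auto simp: eq)
  then have "card {i. i < d \<and> 0 \<le> f i} \<le> card {i. i < d \<and> 0 < f' i}"
    by (intro card_mono) auto
  with median_zero_card_nonneg[OF d f] f' show False by (simp add: median_zero_def)
qed

section \<open>Polytopes of odd circuits of vectors\<close>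

lemma int_span_image:
  assumes "inj_on w I"
  shows "int_span (w ` I) = range (\<lambda>c :: 'i \<Rightarrow> int. \<Sum>i\<in>I. of_int (c i) *\<^sub>R w i)"
proof (intro equalityI subsetI)
  fix x assume "x \<in> int_span (w ` I)"
  then obtain c where "x = (\<Sum>i\<in>I. of_int (c (w i)) *\<^sub>R w i)"
    using assms by (auto simp: int_span_def sum.reindex)
  then show "x \<in> range (\<lambda>c :: 'i \<Rightarrow> int. \<Sum>i\<in>I. of_int (c i) *\<^sub>R w i)"
    by (rule range_eqI[of _ _ "\<lambda>i. c (w i)"])
next
  fix x assume "x \<in> range (\<lambda>c :: 'i \<Rightarrow> int. \<Sum>i\<in>I. of_int (c i) *\<^sub>R w i)"
  then obtain c where "x = (\<Sum>i\<in>I. of_int (c i) *\<^sub>R w i)" by blast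
  then have "x = (\<Sum>v\<in>w ` I. of_int (c (the_inv_into I w v)) *\<^sub>R v)"
    using assms by (simp add: sum.reindex the_inv_into_f_f)
  then show "x \<in> int_span (w ` I)"
    by (auto simp: int_span_def intro: range_eqI[of _ _ "\<lambda>v. c (the_inv_into I w v)"])
qed

lemma odd_sum_int:
  fixes s :: "nat \<Rightarrow> int"
  assumes "\<And>i. i < n \<Longrightarrow> odd (s i)"
  shows "odd (\<Sum>i<n. s i) \<longleftrightarrow> odd n"
  using assms by (induction n) auto

text \<open>
  Everything about the polytope and its lattice follows from the fact that, up to scaling,
  \<open>\<Sum>i<d. u i = 0\<close> is the only linear relation between the \<open>u i\<close>. Coefficient vectors are
  therefore unique up to adding a constant, which is the only freedom used below.
\<close>

locale odd_circuit =
  fixes d k :: nat and u :: "nat \<Rightarrow> 'a::euclidean_space"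
  assumes d_eq: "d = 2 * k + 1"
    and sum_zero: "(\<Sum>i<d. u i) = 0"
    and only_relation:
      "\<And>c i j. (\<Sum>l<d. c l *\<^sub>R u l) = 0 \<Longrightarrow> i < d \<Longrightarrow> j < d \<Longrightarrow> c i = (c j :: real)"
begin

definition lat :: "'a set" where
  "lat = range (\<lambda>c :: nat \<Rightarrow> int. \<Sum>i<d. of_int (c i) *\<^sub>R u i)"

definition gens :: "'a set" where
  "gens = insert 0 (u ` {..<d} \<union> (\<lambda>i. - u i) ` {..<d})"

definition body :: "'a set" where
  "body = convex hull gens"

lemma d_pos: "0 < d"
  by (simp add: d_eq)

lemma latI: "(\<Sum>i<d. of_int (c i) *\<^sub>R u i) \<in> lat"
  by (auto simp: lat_def)

lemma sum_same_coeff_eq_0: "(\<Sum>i<d. t *\<^sub>R u i) = 0"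
  by (simp add: sum_zero flip: scaleR_sum_right)

lemma u_in_lat: "i < d \<Longrightarrow> u i \<in> lat"
proof -
  assume i: "i < d"
  have "(\<Sum>l<d. of_int (if l = i then 1 else 0) *\<^sub>R u l) = (\<Sum>l<d. if l = i then u l else 0)"
    by (intro sum.cong) auto
  also have "\<dots> = u i" using i by simp
  finally show ?thesis using latI[of "\<lambda>l. if l = i then 1 else 0"] by simp
qed

lemma gens_subset_lat: "gens \<subseteq> lat"
proof -
  have "0 \<in> lat" using latI[of "\<lambda>_. 0"] by simp
  moreover have "- x \<in> lat" if "x \<in> lat" for x
  proof -
    from that obtain c where "x = (\<Sum>i<d. of_int (c i) *\<^sub>R u i)" by (auto simp: lat_def)
    then show ?thesis using latI[of "\<lambda>i. - c i"] by (simp add: sum_negf)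
  qed
  ultimately show ?thesis by (auto simp: gens_def u_in_lat)
qed

lemma finite_gens: "finite gens"
  by (simp add: gens_def)

lemma signed_independent:
  assumes j: "j < d" and \<sigma>: "\<And>i. \<sigma> i \<noteq> (0 :: real)"
  defines "I \<equiv> {..<d} - {j}"
  shows "inj_on (\<lambda>i. \<sigma> i *\<^sub>R u i) I" and "independent ((\<lambda>i. \<sigma> i *\<^sub>R u i) ` I)"
proof -
  have key: "c i = 0" if "(\<Sum>l\<in>I. c l *\<^sub>R \<sigma> l *\<^sub>R u l) = 0" "i \<in> I" for c i
  proof -
    have "(\<Sum>l<d. (if l = j then 0 else c l * \<sigma> l) *\<^sub>R u l) = (\<Sum>l\<in>I. c l *\<^sub>R \<sigma> l *\<^sub>R u l)"
      unfolding I_def by (intro sum.mono_neutral_cong_right) auto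
    then have "(if i = j then 0 else c i * \<sigma> i) = (if j = j then 0 else c j * \<sigma> j)"
      using that j by (intro only_relation[where c = "\<lambda>l. if l = j then 0 else c l * \<sigma> l"]) (auto simp: I_def)
    then show ?thesis using that \<sigma>[of i] by (simp add: I_def)
  qed
  show inj: "inj_on (\<lambda>i. \<sigma> i *\<^sub>R u i) I"
  proof (rule inj_onI, rule ccontr)
    fix i i' assume i: "i \<in> I" "i' \<in> I" and eq: "\<sigma> i *\<^sub>R u i = \<sigma> i' *\<^sub>R u i'" and ne: "i \<noteq> i'"
    have "(\<Sum>l\<in>I. (if l = i then 1 else if l = i' then - 1 else 0) *\<^sub>R \<sigma> l *\<^sub>R u l)
        = (\<Sum>l\<in>{i, i'}. (if l = i then 1 else if l = i' then - 1 else 0) *\<^sub>R \<sigma> l *\<^sub>R u l)"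
      using i by (intro sum.mono_neutral_right) (auto simp: I_def)
    also have "\<dots> = 0" using ne eq by simp
    finally show False using key[of "\<lambda>l. if l = i then 1 else if l = i' then - 1 else 0" i] i by simp
  qed
  show "independent ((\<lambda>i. \<sigma> i *\<^sub>R u i) ` I)"
  proof (rule independent_if_scalars_zero)
    fix f x assume f: "(\<Sum>x\<in>(\<lambda>i. \<sigma> i *\<^sub>R u i) ` I. f x *\<^sub>R x) = 0" and x: "x \<in> (\<lambda>i. \<sigma> i *\<^sub>R u i) ` I"
    then show "f x = 0"
      using key[of "\<lambda>i. f (\<sigma> i *\<^sub>R u i)"] inj by (auto simp: sum.reindex)
  qed (simp add: I_def)
qed

text \<open>
  Any \<open>d - 1\<close> of the vectors, with arbitrary signs, form a basis of the lattice. Facets turn out to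
  have such vertex sets.
\<close>

lemma signed_int_basis:
  assumes j: "j < d" and \<sigma>: "\<And>i. \<sigma> i = (1 :: real) \<or> \<sigma> i = - 1"
  defines "I \<equiv> {..<d} - {j}"
  shows "is_int_basis lat ((\<lambda>i. \<sigma> i *\<^sub>R u i) ` I)"
proof -
  let ?w = "\<lambda>i. \<sigma> i *\<^sub>R u i"
  have nz: "\<sigma> i \<noteq> 0" for i using \<sigma>[of i] by auto
  note inj = signed_independent(1)[OF j, of \<sigma>, OF nz, folded I_def]
  note ind = signed_independent(2)[OF j, of \<sigma>, OF nz, folded I_def]
  define s :: "nat \<Rightarrow> int" where "s i = (if \<sigma> i = 1 then 1 else - 1)" for i
  have s: "\<sigma> i = of_int (s i)" "s i * s i = 1" for i using \<sigma>[of i] by (auto simp: s_def)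
  have "lat = int_span (?w ` I)"
    unfolding int_span_image[OF inj]
  proof (intro equalityI subsetI)
    fix x assume "x \<in> lat"
    then obtain c where x: "x = (\<Sum>i<d. of_int (c i) *\<^sub>R u i)" by (auto simp: lat_def)
    \<comment> \<open>shifting by the relation kills the coefficient of the omitted vector\<close>
    have "x = x - (\<Sum>i<d. real_of_int (c j) *\<^sub>R u i)" by (simp add: sum_same_coeff_eq_0)
    also have "\<dots> = (\<Sum>i<d. of_int (c i - c j) *\<^sub>R u i)"
      by (simp add: x scaleR_left_diff_distrib sum_subtractf)
    also have "\<dots> = (\<Sum>i\<in>I. of_int (c i - c j) *\<^sub>R u i)"
      unfolding I_def by (intro sum.mono_neutral_right) auto
    also have "\<dots> = (\<Sum>i\<in>I. of_int ((c i - c j) * s i) *\<^sub>R ?w i)"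
    proof (intro sum.cong refl)
      fix i
      have "of_int ((c i - c j) * s i) *\<^sub>R ?w i = of_int ((c i - c j) * (s i * s i)) *\<^sub>R u i"
        by (simp add: s(1) algebra_simps)
      then show "of_int (c i - c j) *\<^sub>R u i = of_int ((c i - c j) * s i) *\<^sub>R ?w i"
        by (simp only: s(2) mult_1_right)
    qed
    finally show "x \<in> range (\<lambda>c :: nat \<Rightarrow> int. \<Sum>i\<in>I. of_int (c i) *\<^sub>R ?w i)"
      by (rule range_eqI[of _ _ "\<lambda>i. (c i - c j) * s i"])
  next
    fix x assume "x \<in> range (\<lambda>c :: nat \<Rightarrow> int. \<Sum>i\<in>I. of_int (c i) *\<^sub>R ?w i)"
    then obtain c :: "nat \<Rightarrow> int" where x: "x = (\<Sum>i\<in>I. of_int (c i) *\<^sub>R ?w i)" by blast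
    have "x = (\<Sum>i<d. of_int (if i = j then 0 else c i * s i) *\<^sub>R u i)"
      unfolding x I_def by (intro sum.mono_neutral_cong_left) (auto simp: s(1))
    then show "x \<in> lat" using latI by simp
  qed
  moreover have "c b = 0" if "(\<Sum>b\<in>?w ` I. of_int (c b) *\<^sub>R b) = 0" "b \<in> ?w ` I" for c :: "'a \<Rightarrow> int" and b
    using independentD[OF ind _ subset_refl that] by (simp add: I_def)
  ultimately show ?thesis
    by (auto simp: is_int_basis_def I_def)
qed

lemma independent_u: "j < d \<Longrightarrow> independent (u ` ({..<d} - {j}))"
  using signed_independent(2)[of j "\<lambda>_. 1"] by simp

lemma inj_on_u: "j < d \<Longrightarrow> inj_on u ({..<d} - {j})"
  using signed_independent(1)[of j "\<lambda>_. 1"] by simp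

lemma lat_eq_int_span: "j < d \<Longrightarrow> lat = int_span (u ` ({..<d} - {j}))"
  using signed_int_basis[of j "\<lambda>_. 1"] by (simp add: is_int_basis_def)

lemma is_lattice_lat: "is_lattice lat"
  unfolding is_lattice_def
  by (intro exI[of _ "u ` ({..<d} - {0})"])
    (simp add: lat_eq_int_span[OF d_pos] independent_u[OF d_pos])

lemma span_lat: "span lat = span (u ` ({..<d} - {j}))" if "j < d"
proof
  have "lat \<subseteq> span (u ` ({..<d} - {j}))"
    unfolding lat_eq_int_span[OF that] int_span_def
    by (auto intro: span_sum[OF span_scale[OF span_base]])
  then show "span lat \<subseteq> span (u ` ({..<d} - {j}))"
    by (simp add: span_minimal)
  show "span (u ` ({..<d} - {j})) \<subseteq> span lat"
    using u_in_lat by (intro span_mono) auto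
qed

lemma dim_span_lat: "dim (span lat) = 2 * k"
proof -
  show ?thesis
    unfolding span_lat[OF d_pos] dim_span_eq_card_independent[OF independent_u[OF d_pos]]
      card_image[OF inj_on_u[OF d_pos]]
    using d_eq by simp
qed

lemma u_in_span: "i < d \<Longrightarrow> u i \<in> span lat"
  by (simp add: u_in_lat span_base)

lemma comb_in_span: "(\<Sum>i<d. r i *\<^sub>R u i) \<in> span lat"
  by (auto intro!: span_sum span_scale u_in_span)

lemma span_lat_eq: "span lat = range (\<lambda>r. \<Sum>i<d. r i *\<^sub>R u i)"
proof
  have "subspace (range (\<lambda>r. \<Sum>i<d. r i *\<^sub>R u i))"
  proof (rule subspaceI)
    show "0 \<in> range (\<lambda>r. \<Sum>i<d. r i *\<^sub>R u i)"
      by (rule range_eqI[of _ _ "\<lambda>_. 0"]) simp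
  next
    fix x y assume "x \<in> range (\<lambda>r. \<Sum>i<d. r i *\<^sub>R u i)" "y \<in> range (\<lambda>r. \<Sum>i<d. r i *\<^sub>R u i)"
    then obtain r s where "x = (\<Sum>i<d. r i *\<^sub>R u i)" "y = (\<Sum>i<d. s i *\<^sub>R u i)" by auto
    then show "x + y \<in> range (\<lambda>r. \<Sum>i<d. r i *\<^sub>R u i)"
      by (intro range_eqI[of _ _ "\<lambda>i. r i + s i"]) (simp add: algebra_simps sum.distrib)
  next
    fix c x assume "x \<in> range (\<lambda>r. \<Sum>i<d. r i *\<^sub>R u i)"
    then obtain r where "x = (\<Sum>i<d. r i *\<^sub>R u i)" by auto
    then show "c *\<^sub>R x \<in> range (\<lambda>r. \<Sum>i<d. r i *\<^sub>R u i)"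
      by (intro range_eqI[of _ _ "\<lambda>i. c * r i"]) (simp add: scaleR_sum_right)
  qed
  moreover have "lat \<subseteq> range (\<lambda>r. \<Sum>i<d. r i *\<^sub>R u i)"
    by (auto simp: lat_def)
  ultimately show "span lat \<subseteq> range (\<lambda>r. \<Sum>i<d. r i *\<^sub>R u i)"
    by (rule span_minimal[rotated])
qed (use comb_in_span in auto)

text \<open>
  The polytope is the image of the cross-polytope under the map that sends the standard basis to
  the \<open>u i\<close>.
\<close>

lemma body_iff: "x \<in> body \<longleftrightarrow> (\<exists>r. x = (\<Sum>i<d. r i *\<^sub>R u i) \<and> (\<Sum>i<d. \<bar>r i\<bar>) \<le> 1)"
proof
  let ?C = "{x. \<exists>r. x = (\<Sum>i<d. r i *\<^sub>R u i) \<and> (\<Sum>i<d. \<bar>r i\<bar>) \<le> 1}"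
  have "convex ?C"
  proof (rule convexI)
    fix x y and a b :: real
    assume "x \<in> ?C" "y \<in> ?C" and ab: "0 \<le> a" "0 \<le> b" "a + b = 1"
    then obtain r s where x: "x = (\<Sum>i<d. r i *\<^sub>R u i)" "(\<Sum>i<d. \<bar>r i\<bar>) \<le> 1"
      and y: "y = (\<Sum>i<d. s i *\<^sub>R u i)" "(\<Sum>i<d. \<bar>s i\<bar>) \<le> 1" by blast
    have "(\<Sum>i<d. \<bar>a * r i + b * s i\<bar>) \<le> (\<Sum>i<d. a * \<bar>r i\<bar> + b * \<bar>s i\<bar>)"
      using ab by (intro sum_mono order.trans[OF abs_triangle_ineq]) (simp add: abs_mult)
    also have "\<dots> = a * (\<Sum>i<d. \<bar>r i\<bar>) + b * (\<Sum>i<d. \<bar>s i\<bar>)"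
      by (simp add: sum.distrib sum_distrib_left)
    also have "\<dots> \<le> 1"
      using x(2) y(2) ab by (intro convex_bound_le) auto
    finally show "a *\<^sub>R x + b *\<^sub>R y \<in> ?C"
      by (intro CollectI exI[of _ "\<lambda>i. a * r i + b * s i"])
        (simp add: x y scaleR_sum_right scaleR_left_distrib sum.distrib)
  qed
  moreover have "gens \<subseteq> ?C"
  proof -
    have *: "t *\<^sub>R u i \<in> ?C" if "\<bar>t\<bar> \<le> 1" "i < d" for t i
      using that by (intro CollectI exI[of _ "\<lambda>l. if l = i then t else 0"])
        (simp add: if_distrib[of "\<lambda>t. t *\<^sub>R _"] if_distrib[of abs] cong: if_cong)
    show ?thesis
      using *[of 0 0] *[of 1] *[of "-1"] d_pos
      unfolding gens_def by (auto simp del: mem_Collect_eq)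
  qed
  ultimately have "body \<subseteq> ?C"
    unfolding body_def by (simp add: hull_minimal)
  then show "x \<in> body \<Longrightarrow> \<exists>r. x = (\<Sum>i<d. r i *\<^sub>R u i) \<and> (\<Sum>i<d. \<bar>r i\<bar>) \<le> 1" by blast
next
  assume "\<exists>r. x = (\<Sum>i<d. r i *\<^sub>R u i) \<and> (\<Sum>i<d. \<bar>r i\<bar>) \<le> 1"
  then obtain r where x: "x = (\<Sum>i<d. r i *\<^sub>R u i)" and r: "(\<Sum>i<d. \<bar>r i\<bar>) \<le> 1" by blast
  define a where "a i = (if i < d then \<bar>r i\<bar> else 1 - (\<Sum>i<d. \<bar>r i\<bar>))" for i
  define v where "v i = (if i < d then if 0 \<le> r i then u i else - u i else 0)" for i
  have "(\<Sum>i\<le>d. a i *\<^sub>R v i) \<in> body"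
  proof (rule convex_sum)
    show "v i \<in> body" for i
      unfolding body_def by (rule hull_inc) (auto simp: v_def gens_def)
  qed (use r in \<open>auto simp: body_def a_def simp flip: lessThan_Suc_atMost\<close>)
  also have "(\<Sum>i\<le>d. a i *\<^sub>R v i) = x"
    unfolding x lessThan_Suc_atMost[symmetric] by (simp add: a_def v_def) (intro sum.cong, auto)
  finally show "x \<in> body" .
qed

lemma zero_in_body: "0 \<in> body"
  unfolding body_def by (rule hull_inc) (simp add: gens_def)

lemma u_in_body: "i < d \<Longrightarrow> u i \<in> body" "i < d \<Longrightarrow> - u i \<in> body"
  unfolding body_def by (auto intro!: hull_inc simp: gens_def)

lemma uminus_body: "x \<in> body \<Longrightarrow> - x \<in> body"
proof -
  assume "x \<in> body"
  then obtain r where "x = (\<Sum>i<d. r i *\<^sub>R u i)" "(\<Sum>i<d. \<bar>r i\<bar>) \<le> 1" by (auto simp: body_iff)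
  then show ?thesis
    unfolding body_iff by (intro exI[of _ "\<lambda>i. - r i"]) (simp add: sum_negf)
qed

lemma span_body: "span body = span lat"
proof
  show "span body \<subseteq> span lat"
    by (rule span_minimal) (auto simp: body_iff intro: comb_in_span)
  have "lat \<subseteq> span body"
    by (auto simp: lat_def intro: span_sum[OF span_scale[OF span_base[OF u_in_body(1)]]])
  then show "span lat \<subseteq> span body" by (simp add: span_minimal)
qed

lemma affine_hull_body: "affine hull body = span lat"
  by (simp add: affine_hull_span_0 hull_inc zero_in_body span_body)

lemma aff_dim_body: "aff_dim body = 2 * int k"
proof -
  have "aff_dim body = int (dim body)"
    by (rule aff_dim_zero) (simp add: hull_inc zero_in_body)
  also have "dim body = dim (span lat)"
    by (metis dim_span span_body)
  finally show ?thesis using dim_span_lat by simp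
qed

lemma full_dim_body: "full_dim_lattice_polytope lat body"
proof -
  have "lattice_polytope lat body"
    using finite_gens gens_subset_lat unfolding lattice_polytope_def body_def
    by (intro exI[of _ gens]) (auto simp: gens_def)
  then show ?thesis
    using is_lattice_lat aff_dim_body dim_span_lat by (simp add: full_dim_lattice_polytope_def)
qed

text \<open>
  A relative interior point and its negative span a segment whose midpoint \<open>0\<close> is again relatively
  interior.
\<close>

lemma origin_in_interior_body: "origin_in_interior lat body"
proof -
  have cv: "convex body" by (simp add: body_def)
  then obtain a where a: "a \<in> rel_interior body"
    using rel_interior_eq_empty zero_in_body by blast
  have "0 \<in> rel_interior body"
  proof (cases "a = 0")
    case False
    have "- a \<in> closure body"
      using a rel_interior_subset uminus_body closure_subset by blast
    then have "open_segment a (- a) \<subseteq> rel_interior body"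
      using cv a by (intro rel_interior_closure_convex_segment)
    moreover have "midpoint a (- a) \<in> open_segment a (- a)"
      using False by (simp add: eq_neg_iff_add_eq_0 scaleR_2[symmetric])
    ultimately show ?thesis by (auto simp: midpoint_def)
  qed (use a in simp)
  then show ?thesis
    by (auto simp: origin_in_interior_def interior_of_def rel_interior_def affine_hull_body)
qed

text \<open>
  A supporting functional \<open>a\<close> of the facet, with maximum \<open>b > 0\<close>, takes values \<open>g i\<close> on the \<open>u i\<close>
  with \<open>\<bar>g i\<bar> \<le> b\<close> and sum \<open>0\<close>. The vertices of the facet are the signed \<open>u i\<close> with \<open>\<bar>g i\<bar> = b\<close>.
  For dimension reasons there are at least \<open>d - 1\<close> such \<open>i\<close>, and not all \<open>d\<close> of them qualify, because
  \<open>d\<close> is odd. So the vertices are \<open>d - 1\<close> signed generators, which form a lattice basis.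
\<close>

lemma facet_int_basis:
  assumes F: "F facet_of body"
  shows "is_int_basis lat {v. v extreme_point_of F}"
proof -
  have face: "F face_of body" and dimF: "aff_dim F = 2 * int k - 1"
    using F by (auto simp: facet_of_def aff_dim_body)
  have "polyhedron body"
    unfolding body_def by (simp add: finite_gens polytope_convex_hull polytope_imp_polyhedron)
  then have "F exposed_face_of body"
    using face exposed_face_of_polyhedron by blast
  then obtain a b where sub: "body \<subseteq> {x. a \<bullet> x \<le> b}" and F_eq: "F = body \<inter> {x. a \<bullet> x = b}"
    unfolding exposed_face_of_def by blast
  define g where "g i = a \<bullet> u i" for i
  have g_sum: "(\<Sum>i<d. g i) = 0"
    by (simp add: g_def sum_zero flip: inner_sum_right)
  have g_le: "\<bar>g i\<bar> \<le> b" if "i < d" for i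
    using sub u_in_body[OF that] by (auto simp: g_def abs_le_iff)
  have b: "0 < b"
  proof (rule ccontr)
    assume "\<not> 0 < b"
    then have "b = 0" using sub zero_in_body by auto
    then have "a \<bullet> u i = 0" if "i < d" for i using g_le[OF that] by (simp add: g_def)
    then have "a \<bullet> x = 0" if "x \<in> body" for x
      using that by (auto simp: body_iff inner_sum_right)
    then have "F = body" using F_eq \<open>b = 0\<close> by auto
    then show False using dimF aff_dim_body by simp
  qed
  define G where "G = {v \<in> gens. a \<bullet> v = b}"
  have hull: "F = convex hull G"
  proof
    obtain S where S: "S \<subseteq> gens" "F = convex hull S"
      using face_of_convex_hull_subset[of gens F] face finite_gens finite_imp_compact
      unfolding body_def by metis
    then have "S \<subseteq> G"
      using F_eq hull_subset[of S convex] by (auto simp: G_def)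
    then show "F \<subseteq> convex hull G" using S by (simp add: hull_mono)
    have "convex F" using face by (rule face_of_imp_convex)
    moreover have "G \<subseteq> F" using hull_subset[of gens convex] by (auto simp: F_eq G_def body_def)
    ultimately show "convex hull G \<subseteq> F" by (rule hull_minimal[rotated])
  qed
  define I where "I = {i. i < d \<and> \<bar>g i\<bar> = b}"
  define \<sigma> :: "nat \<Rightarrow> real" where "\<sigma> i = (if g i = b then 1 else - 1)" for i
  have G_eq: "G = (\<lambda>i. \<sigma> i *\<^sub>R u i) ` I"
  proof (intro equalityI subsetI)
    fix v assume "v \<in> G"
    then obtain i where i: "i < d" "v = u i \<and> g i = b \<or> v = - u i \<and> g i = - b"
      using b by (auto simp: G_def gens_def g_def)
    then show "v \<in> (\<lambda>i. \<sigma> i *\<^sub>R u i) ` I"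
      using b by (intro image_eqI[of _ _ i]) (auto simp: I_def \<sigma>_def)
  next
    fix v assume "v \<in> (\<lambda>i. \<sigma> i *\<^sub>R u i) ` I"
    then show "v \<in> G" by (auto simp: G_def gens_def I_def \<sigma>_def g_def split: if_splits)
  qed
  \<comment> \<open>an odd number of signs does not sum to zero\<close>
  have "I \<noteq> {..<d}"
  proof
    assume I: "I = {..<d}"
    define s :: "nat \<Rightarrow> int" where "s i = (if g i = b then 1 else - 1)" for i
    have "(\<Sum>i<d. g i) = (\<Sum>i<d. b * of_int (s i))"
    proof (rule sum.cong[OF refl])
      fix i assume "i \<in> {..<d}"
      then have "\<bar>g i\<bar> = b" using I by (auto simp: I_def)
      then show "g i = b * of_int (s i)" by (auto simp: s_def)
    qed
    also have "\<dots> = b * of_int (\<Sum>i<d. s i)"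
      by (simp add: sum_distrib_left)
    finally have "(\<Sum>i<d. s i) = 0" using g_sum b by (simp del: of_int_sum)
    moreover have "odd (\<Sum>i<d. s i)"
      using odd_sum_int[of d s] d_eq by (auto simp: s_def)
    ultimately show False by simp
  qed
  then obtain j where j: "j < d" "j \<notin> I" by (auto simp: I_def)
  then have sub_I: "I \<subseteq> {..<d} - {j}" by (auto simp: I_def)
  have finI: "finite I" by (simp add: I_def)
  have "2 * int k - 1 = aff_dim G" using dimF hull by (simp add: aff_dim_convex_hull)
  also have "\<dots> \<le> int (card G) - 1" using finI by (intro aff_dim_le_card) (simp add: G_eq)
  also have "\<dots> \<le> int (card I) - 1" using finI card_image_le[of I "\<lambda>i. \<sigma> i *\<^sub>R u i"] by (simp add: G_eq)
  finally have "2 * k \<le> card I" by simp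
  then have I: "I = {..<d} - {j}"
    using sub_I j d_eq by (intro card_seteq) auto
  have \<sigma>: "\<sigma> i = 1 \<or> \<sigma> i = - 1" for i by (simp add: \<sigma>_def)
  have nz: "\<sigma> i \<noteq> 0" for i by (simp add: \<sigma>_def)
  have "independent G"
    unfolding G_eq I by (rule signed_independent[OF j(1) nz])
  then have "\<not> affine_dependent G"
    using affine_dependent_imp_dependent by blast
  then have "{v. v extreme_point_of F} = G"
    unfolding hull by (simp add: extreme_point_of_convex_hull_affine_independent)
  then show ?thesis
    using signed_int_basis[OF j(1) \<sigma>] by (simp add: G_eq I)
qed

lemma inner_relation:
  assumes "i < d"
  shows "u i \<bullet> y = - (\<Sum>l\<in>{..<d} - {i}. u l \<bullet> y)"
proof -
  have "0 = (\<Sum>l<d. u l \<bullet> y)"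
    by (simp add: sum_zero flip: inner_sum_left)
  also have "\<dots> = u i \<bullet> y + (\<Sum>l\<in>{..<d} - {i}. u l \<bullet> y)"
    using assms by (intro sum.remove) auto
  finally show ?thesis by simp
qed

lemma dual_polytope_iff:
  "y \<in> dual_polytope lat body \<longleftrightarrow> y \<in> span lat \<and> (\<forall>i<d. \<bar>u i \<bullet> y\<bar> \<le> 1)"
proof (intro iffI conjI allI impI)
  fix i assume y: "y \<in> dual_polytope lat body" and i: "i < d"
  then have "u i \<bullet> y \<le> 1" "(- u i) \<bullet> y \<le> 1"
    using u_in_body[OF i] unfolding dual_polytope_def by blast+
  then show "\<bar>u i \<bullet> y\<bar> \<le> 1" by simp
next
  assume y: "y \<in> span lat \<and> (\<forall>i<d. \<bar>u i \<bullet> y\<bar> \<le> 1)"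
  have "x \<bullet> y \<le> 1" if x_body: "x \<in> body" for x
  proof -
    obtain r where x: "x = (\<Sum>i<d. r i *\<^sub>R u i)" and r: "(\<Sum>i<d. \<bar>r i\<bar>) \<le> 1"
      using x_body unfolding body_iff by blast
    have "x \<bullet> y = (\<Sum>i<d. r i * (u i \<bullet> y))" by (simp add: x inner_sum_left)
    also have "\<dots> \<le> (\<Sum>i<d. \<bar>r i\<bar>)"
    proof (rule sum_mono)
      fix i assume "i \<in> {..<d}"
      then have "\<bar>r i\<bar> * \<bar>u i \<bullet> y\<bar> \<le> \<bar>r i\<bar> * 1"
        using y by (intro mult_left_mono) auto
      then show "r i * (u i \<bullet> y) \<le> \<bar>r i\<bar>"
        using abs_ge_self[of "r i * (u i \<bullet> y)"] by (simp add: abs_mult)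
    qed
    finally show ?thesis using r by simp
  qed
  then show "y \<in> dual_polytope lat body" using y by (simp add: dual_polytope_def)
qed (auto simp: dual_polytope_def)

lemma dual_latticeI:
  assumes "y \<in> span lat" "\<And>i. i < d \<Longrightarrow> u i \<bullet> y \<in> \<int>"
  shows "y \<in> dual_lattice lat"
  using assms by (auto simp: dual_lattice_def lat_def inner_sum_left intro!: Ints_sum Ints_mult)

text \<open>
  The pairings with \<open>d - 1\<close> of the \<open>u i\<close> can be prescribed freely; the relation determines the
  last one.
\<close>

lemma dual_vector_exists:
  assumes ij: "i < d" "j < d" "i \<noteq> j"
  obtains z where "z \<in> span lat"
    and "\<And>l. l < d \<Longrightarrow> u l \<bullet> z = (if l = i then 1 else if l = j then - 1 else 0)"
proof -
  let ?I = "{..<d} - {j}"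
  obtain g :: "'a \<Rightarrow> real" where g: "linear g" "\<forall>x\<in>u ` ?I. g x = (if x = u i then 1 else 0)"
    using linear_independent_extend[OF independent_u[OF ij(2)], of "\<lambda>x. if x = u i then 1 else 0"]
    by blast
  define w where "w = (\<Sum>b\<in>Basis. g b *\<^sub>R b)"
  have gw: "g x = x \<bullet> w" for x
  proof -
    have "g x = g (\<Sum>b\<in>Basis. (x \<bullet> b) *\<^sub>R b)" by (simp add: euclidean_representation)
    also have "\<dots> = (\<Sum>b\<in>Basis. (x \<bullet> b) * g b)"
      using g(1) by (simp add: linear_sum linear_scale)
    finally show ?thesis by (simp add: w_def inner_sum_right mult.commute)
  qed
  obtain z z' where z: "z \<in> span lat" and z': "\<And>x. x \<in> span lat \<Longrightarrow> orthogonal z' x"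
    and w: "w = z + z'"
    using orthogonal_subspace_decomp_exists[of lat w] by metis
  have uz: "u l \<bullet> z = g (u l)" if "l < d" for l
    using z'[OF u_in_span[OF that]]
    by (simp add: gw w inner_add_right orthogonal_def inner_commute)
  have main: "u l \<bullet> z = (if l = i then 1 else 0)" if "l \<in> ?I" for l
    using that g(2) inj_on_u[OF ij(2)] ij by (auto simp: uz inj_on_def)
  have "u j \<bullet> z = - (\<Sum>l\<in>?I. u l \<bullet> z)" by (rule inner_relation[OF ij(2)])
  also have "(\<Sum>l\<in>?I. u l \<bullet> z) = (\<Sum>l\<in>?I. if l = i then 1 else 0)"
    using main by (intro sum.cong) auto
  finally have "u j \<bullet> z = - 1" using ij by simp
  with main ij z show ?thesis by (intro that[of z]) auto
qed

lemma span_lat_eqI: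
  assumes "y \<in> span lat" "y' \<in> span lat" "\<And>i. i < d \<Longrightarrow> u i \<bullet> y = u i \<bullet> y'"
  shows "y = y'"
proof -
  have "y - y' \<in> span lat" using assms by (simp add: span_diff)
  then obtain r where r: "y - y' = (\<Sum>i<d. r i *\<^sub>R u i)" by (auto simp: span_lat_eq)
  have "(y - y') \<bullet> (y - y') = (\<Sum>i<d. r i * (u i \<bullet> (y - y')))"
    by (subst (1) r) (simp add: inner_sum_left)
  also have "\<dots> = 0" using assms(3) by (simp add: inner_diff_right)
  finally show ?thesis by simp
qed

lemma compact_dual_polytope: "compact (dual_polytope lat body)"
proof -
  have eq: "dual_polytope lat body
      = span lat \<inter> (\<Inter>i\<in>{..<d}. {y. u i \<bullet> y \<le> 1} \<inter> {y. - u i \<bullet> y \<le> 1})"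
    by (auto simp: dual_polytope_iff abs_le_iff)
  have "closed (dual_polytope lat body)"
    unfolding eq by (intro closed_Int closed_INT ballI closed_halfspace_le closed_span)
  moreover have "bounded (dual_polytope lat body)"
  proof -
    obtain T where T: "openin (top_of_set (span lat)) T" "0 \<in> T" "T \<subseteq> body"
      using origin_in_interior_body by (auto simp: origin_in_interior_def interior_of_def)
    then obtain \<epsilon> where \<epsilon>: "0 < \<epsilon>" "ball 0 \<epsilon> \<inter> span lat \<subseteq> T"
      using openin_contains_ball by metis
    have "norm y \<le> 2 / \<epsilon>" if y: "y \<in> dual_polytope lat body" for y
    proof (cases "y = 0")
      case False
      let ?x = "(\<epsilon> / 2 / norm y) *\<^sub>R y"
      have "?x \<in> ball 0 \<epsilon> \<inter> span lat"
        using y False \<epsilon>(1) by (auto simp: dual_polytope_def span_scale)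
      then have "?x \<in> body" using \<epsilon>(2) T(3) by blast
      then have "?x \<bullet> y \<le> 1" using y unfolding dual_polytope_def by blast
      moreover have "?x \<bullet> y = \<epsilon> / 2 * norm y"
        using False by (simp add: dot_square_norm power2_eq_square)
      ultimately show ?thesis
        using \<epsilon>(1) by (simp add: field_simps)
    qed (use \<epsilon> in simp)
    then show ?thesis by (auto simp: bounded_iff)
  qed
  ultimately show ?thesis by (simp add: compact_eq_bounded_closed)
qed

lemma convex_dual_polytope: "convex (dual_polytope lat body)"
proof -
  have eq: "dual_polytope lat body
      = span lat \<inter> (\<Inter>i\<in>{..<d}. {y. u i \<bullet> y \<le> 1} \<inter> {y. - u i \<bullet> y \<le> 1})"
    by (auto simp: dual_polytope_iff abs_le_iff)
  show ?thesis
    unfolding eq by (intro convex_Int convex_INT convex_halfspace_le subspace_imp_convex subspace_span)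
qed

text \<open>
  If \<open>y\<close> satisfies two of the inequalities \<open>\<bar>u l \<bullet> y\<bar> \<le> 1\<close> strictly, then it can be moved in both
  directions along a vector that increases one of the two pairings, decreases the other, and fixes
  the rest; so \<open>y\<close> is not extreme. Hence at most one pairing differs from \<open>\<plusminus>1\<close>, and that one is an
  integer because the pairings have sum \<open>0\<close>.
\<close>

lemma dual_vertex_integral:
  assumes y: "y extreme_point_of dual_polytope lat body" and i: "i < d"
  shows "u i \<bullet> y \<in> {-1, 0, 1}"
proof -
  have yD: "y \<in> dual_polytope lat body" using y by (simp add: extreme_point_of_def)
  then have ys: "y \<in> span lat" and yle: "\<And>l. l < d \<Longrightarrow> \<bar>u l \<bullet> y\<bar> \<le> 1"
    by (auto simp: dual_polytope_iff)
  have unique: "l = l'" if l: "l < d" "\<bar>u l \<bullet> y\<bar> < 1" and l': "l' < d" "\<bar>u l' \<bullet> y\<bar> < 1" for l l'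
  proof (rule ccontr)
    assume "l \<noteq> l'"
    then obtain z where z: "z \<in> span lat"
      and uz: "\<And>n. n < d \<Longrightarrow> u n \<bullet> z = (if n = l then 1 else if n = l' then - 1 else 0)"
      using dual_vector_exists l l' by metis
    define \<epsilon> where "\<epsilon> = min (1 - \<bar>u l \<bullet> y\<bar>) (1 - \<bar>u l' \<bullet> y\<bar>)"
    have \<epsilon>: "0 < \<epsilon>" using l l' by (simp add: \<epsilon>_def)
    have in_dual: "y + t *\<^sub>R z \<in> dual_polytope lat body" if "\<bar>t\<bar> = \<epsilon>" for t
      unfolding dual_polytope_iff
    proof (intro conjI allI impI)
      fix n assume n: "n < d"
      show "\<bar>u n \<bullet> (y + t *\<^sub>R z)\<bar> \<le> 1"
        using yle[OF n] that by (auto simp: inner_add_right uz n \<epsilon>_def min_def split: if_splits)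
    qed (use ys z in \<open>simp add: span_add span_scale\<close>)
    have "z \<noteq> 0" using uz[OF l(1)] by auto
    then have "y + \<epsilon> *\<^sub>R z \<noteq> y + (- \<epsilon>) *\<^sub>R z"
      using \<epsilon> by (simp add: eq_neg_iff_add_eq_0 flip: scaleR_2)
    moreover have "midpoint (y + \<epsilon> *\<^sub>R z) (y + (- \<epsilon>) *\<^sub>R z) = y"
      by (simp add: midpoint_def scaleR_2[symmetric] algebra_simps)
    ultimately have "y \<in> open_segment (y + \<epsilon> *\<^sub>R z) (y + (- \<epsilon>) *\<^sub>R z)"
      using midpoint_in_open_segment by metis
    then show False
      using y in_dual[of \<epsilon>] in_dual[of "- \<epsilon>"] \<epsilon> by (auto simp: extreme_point_of_def)
  qed
  show ?thesis
  proof (cases "\<bar>u i \<bullet> y\<bar> = 1")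
    case True
    then show ?thesis by auto
  next
    case False
    then have lt: "\<bar>u i \<bullet> y\<bar> < 1" using yle[OF i] by simp
    have "u l \<bullet> y \<in> \<int>" if "l \<in> {..<d} - {i}" for l
    proof -
      have "\<bar>u l \<bullet> y\<bar> = 1" using unique[of l i] yle[of l] lt i that by force
      then show ?thesis by (auto simp: abs_eq_iff' )
    qed
    then have "(\<Sum>l\<in>{..<d} - {i}. u l \<bullet> y) \<in> \<int>" by (rule Ints_sum)
    then have "u i \<bullet> y \<in> \<int>" by (subst inner_relation[OF i]) simp
    then show ?thesis using lt Ints_nonzero_abs_less1 by blast
  qed
qed

lemma dual_lattice_polytope: "lattice_polytope (dual_lattice lat) (dual_polytope lat body)"
proof -
  let ?D = "dual_polytope lat body" and ?V = "{y. y extreme_point_of dual_polytope lat body}"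
  have hull: "?D = convex hull ?V"
    by (rule Krein_Milman_Minkowski[OF compact_dual_polytope convex_dual_polytope])
  have V: "y \<in> span lat" "\<And>i. i < d \<Longrightarrow> u i \<bullet> y \<in> {-1, 0, 1}" if "y \<in> ?V" for y
    using that dual_vertex_integral by (auto simp: extreme_point_of_def dual_polytope_iff)
  have "inj_on (\<lambda>y. \<lambda>i\<in>{..<d}. u i \<bullet> y) ?V"
  proof (rule inj_onI)
    fix y y' assume "y \<in> ?V" "y' \<in> ?V" "(\<lambda>i\<in>{..<d}. u i \<bullet> y) = (\<lambda>i\<in>{..<d}. u i \<bullet> y')"
    then show "y = y'"
      by (intro span_lat_eqI V) (auto simp: fun_eq_iff restrict_def split: if_splits)
  qed
  moreover have "(\<lambda>y. \<lambda>i\<in>{..<d}. u i \<bullet> y) ` ?V \<subseteq> {..<d} \<rightarrow>\<^sub>E {-1, 0, 1}"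
  proof (rule image_subsetI, rule PiE_I)
    fix y i assume y: "y \<in> ?V" and i: "i \<in> {..<d}"
    then show "(\<lambda>i\<in>{..<d}. u i \<bullet> y) i \<in> {-1, 0, 1}" using V(2)[OF y, of i] by simp
  qed auto
  ultimately have "finite ?V"
    by (rule inj_on_finite) (auto intro: finite_PiE)
  moreover have "?V \<noteq> {}"
  proof -
    have "0 \<in> ?D" by (simp add: dual_polytope_iff span_zero)
    then show ?thesis using hull by (metis convex_hull_empty empty_iff)
  qed
  moreover have "?V \<subseteq> dual_lattice lat"
  proof
    fix y assume y: "y \<in> ?V"
    have "u i \<bullet> y \<in> \<int>" if "i < d" for i using V(2)[OF y that] by auto
    then show "y \<in> dual_lattice lat" using V(1)[OF y] by (intro dual_latticeI)
  qed
  ultimately show ?thesis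
    unfolding lattice_polytope_def using hull by blast
qed

lemma smooth_fano_body: "smooth_fano lat body"
  by (simp add: smooth_fano_def full_dim_body origin_in_interior_body facet_int_basis)

lemma gorenstein_fano_body: "gorenstein_fano lat body"
  by (simp add: gorenstein_fano_def full_dim_body origin_in_interior_body dual_lattice_polytope)

lemma dilated_body_iff:
  assumes "1 \<le> m"
  shows "x \<in> (\<lambda>x. real m *\<^sub>R x) ` body \<longleftrightarrow>
    (\<exists>r. x = (\<Sum>i<d. r i *\<^sub>R u i) \<and> (\<Sum>i<d. \<bar>r i\<bar>) \<le> real m)"
proof
  assume "x \<in> (\<lambda>x. real m *\<^sub>R x) ` body"
  then obtain y where y: "y \<in> body" and xy: "x = real m *\<^sub>R y" by blast
  obtain r where yr: "y = (\<Sum>i<d. r i *\<^sub>R u i)" and r: "(\<Sum>i<d. \<bar>r i\<bar>) \<le> 1"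
    using y unfolding body_iff by blast
  have x: "x = real m *\<^sub>R (\<Sum>i<d. r i *\<^sub>R u i)" using xy yr by simp
  have "(\<Sum>i<d. \<bar>real m * r i\<bar>) = real m * (\<Sum>i<d. \<bar>r i\<bar>)"
    by (simp add: abs_mult sum_distrib_left)
  also have "\<dots> \<le> real m" using r by (intro mult_left_le) auto
  finally show "\<exists>r. x = (\<Sum>i<d. r i *\<^sub>R u i) \<and> (\<Sum>i<d. \<bar>r i\<bar>) \<le> real m"
    by (intro exI[of _ "\<lambda>i. real m * r i"]) (simp add: x scaleR_sum_right)
next
  assume "\<exists>r. x = (\<Sum>i<d. r i *\<^sub>R u i) \<and> (\<Sum>i<d. \<bar>r i\<bar>) \<le> real m"
  then obtain r where x: "x = (\<Sum>i<d. r i *\<^sub>R u i)" and r: "(\<Sum>i<d. \<bar>r i\<bar>) \<le> real m" by blast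
  have "(\<Sum>i<d. \<bar>r i / real m\<bar>) \<le> 1"
    using r assms by (simp flip: sum_divide_distrib)
  then have "(\<Sum>i<d. (r i / real m) *\<^sub>R u i) \<in> body" by (auto simp: body_iff)
  moreover have "x = real m *\<^sub>R (\<Sum>i<d. (r i / real m) *\<^sub>R u i)"
    using assms by (simp add: x scaleR_sum_right)
  ultimately show "x \<in> (\<lambda>x. real m *\<^sub>R x) ` body" by blast
qed

lemma combinations_eq_imp_shift:
  assumes "(\<Sum>i<d. r i *\<^sub>R u i) = (\<Sum>i<d. s i *\<^sub>R u i)"
  obtains t where "\<And>i. i < d \<Longrightarrow> s i = r i + (t :: real)"
proof -
  have "(\<Sum>i<d. (s i - r i) *\<^sub>R u i) = 0"
    using assms by (simp add: scaleR_left_diff_distrib sum_subtractf)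
  then have "s i - r i = s 0 - r 0" if "i < d" for i
    using only_relation[of "\<lambda>i. s i - r i"] that d_pos by blast
  then show ?thesis by (intro that[of "s 0 - r 0"]) (auto simp: algebra_simps)
qed

text \<open>
  A lattice point has integer coefficients that are unique up to adding a constant. Normalising
  them to median \<open>0\<close> makes them unique, and by \<open>median_zero_minimal\<close> no other choice, even a real
  one, has a smaller sum of absolute values. So the point lies in the \<open>m\<close>-th dilate if and only if
  this sum is at most \<open>m\<close>.
\<close>

lemma card_dilated_body:
  assumes m: "1 \<le> m"
  shows "card ((\<lambda>x. real m *\<^sub>R x) ` body \<inter> lat) = card (balanced k d m)"
proof -
  let ?P = "\<lambda>f :: nat \<Rightarrow> int. \<Sum>i<d. of_int (f i) *\<^sub>R u i"
  have "bij_betw ?P (balanced k d m) ((\<lambda>x. real m *\<^sub>R x) ` body \<inter> lat)"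
    unfolding bij_betw_def
  proof (intro conjI inj_onI equalityI subsetI)
    fix f f' assume f: "f \<in> balanced k d m" and f': "f' \<in> balanced k d m" and "?P f = ?P f'"
    then obtain t :: real where t: "\<And>i. i < d \<Longrightarrow> of_int (f' i) = of_int (f i) + t"
      using combinations_eq_imp_shift[of "\<lambda>i. of_int (f i)" "\<lambda>i. of_int (f' i)"] by blast
    define n where "n = f' 0 - f 0"
    have n: "f' i = f i + n" if "i < d" for i
      using t[OF that] t[OF d_pos] by (simp add: n_def flip: of_int_eq_iff[where 'a = real])
    have "n \<le> 0"
      using median_zero_shift_unique[OF d_eq _ _ n] f f' by (auto simp: balanced_def)
    moreover have "- n \<le> 0"
      using median_zero_shift_unique[OF d_eq, of f' f "- n"] f f' n by (simp add: balanced_def)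
    ultimately have "f i = f' i" for i
      using f f' n[of i] by (cases "i < d") (auto simp: balanced_def)
    then show "f = f'" by (rule ext)
  next
    fix x assume "x \<in> ?P ` balanced k d m"
    then obtain f where x: "x = ?P f" and f: "f \<in> balanced k d m" by blast
    then have "real_of_int (\<Sum>i<d. \<bar>f i\<bar>) \<le> real m"
      by (simp only: balanced_def mem_Collect_eq) linarith
    then have "x \<in> (\<lambda>x. real m *\<^sub>R x) ` body"
      unfolding dilated_body_iff[OF m] x by (intro exI[of _ "\<lambda>i. of_int (f i)"]) simp
    moreover have "x \<in> lat" unfolding x by (rule latI)
    ultimately show "x \<in> (\<lambda>x. real m *\<^sub>R x) ` body \<inter> lat" by (rule IntI)
  next
    fix x assume x: "x \<in> (\<lambda>x. real m *\<^sub>R x) ` body \<inter> lat"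
    then obtain c :: "nat \<Rightarrow> int" where c: "x = ?P c" by (auto simp: lat_def)
    obtain t where t: "median_zero k d (\<lambda>i. c i - t)" using median_exists[OF d_eq] .
    define f where "f i = (if i < d then c i - t else 0)" for i
    have f: "median_zero k d f"
      using t by (simp add: median_zero_def f_def cong: conj_cong)
    have "?P f = ?P c - (\<Sum>i<d. real_of_int t *\<^sub>R u i)"
      by (simp add: f_def scaleR_left_diff_distrib sum_subtractf)
    then have xf: "x = ?P f" by (simp add: c sum_same_coeff_eq_0)
    obtain r where r: "x = (\<Sum>i<d. r i *\<^sub>R u i)" "(\<Sum>i<d. \<bar>r i\<bar>) \<le> real m"
      using x dilated_body_iff[OF m] by auto
    obtain s where s: "\<And>i. i < d \<Longrightarrow> r i = of_int (f i) + s"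
      using combinations_eq_imp_shift[of "\<lambda>i. of_int (f i)" r] xf r(1) by auto
    have "real_of_int (\<Sum>i<d. \<bar>f i\<bar>) = (\<Sum>i<d. \<bar>of_int (f i)\<bar>)" by simp
    also have "\<dots> \<le> (\<Sum>i<d. \<bar>of_int (f i) + s\<bar>)"
      by (rule median_zero_minimal[OF d_eq f])
    also have "\<dots> = (\<Sum>i<d. \<bar>r i\<bar>)" using s by (intro sum.cong) auto
    also note r(2)
    finally have "(\<Sum>i<d. \<bar>f i\<bar>) \<le> int m" by linarith
    then have "f \<in> balanced k d m" using f by (simp add: balanced_def f_def)
    then show "x \<in> ?P ` balanced k d m" using xf by blast
  qed
  then show ?thesis by (rule bij_betw_same_card[symmetric])
qed

end

section \<open>A root of the counting polynomial to the right of its degree\<close>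

text \<open>
  If no root lies to the right of \<open>Re z\<close>, then moving right from \<open>z\<close> does not bring the argument
  closer to any root, so by the factorisation into linear factors the absolute value of \<open>p\<close> does not
  decrease. A drop of the absolute value thus certifies a root without locating it.
\<close>

lemma exists_root_Re_greater:
  fixes p :: "complex poly"
  assumes z: "a \<le> Re z" and w: "Re z \<le> Re w" "Im w = Im z"
    and less: "cmod (poly p w) < cmod (poly p z)"
  shows "\<exists>\<alpha>. poly p \<alpha> = 0 \<and> a < Re \<alpha>"
proof (rule ccontr)
  assume "\<not> ?thesis"
  then have left: "Re \<alpha> \<le> a" if "poly p \<alpha> = 0" for \<alpha>
    using that by force
  have eval: "cmod (poly p x)
      = cmod (lead_coeff p) * (\<Prod>\<alpha> | poly p \<alpha> = 0. cmod (x - \<alpha>) ^ order \<alpha> p)" for x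
    by (subst (1) complex_poly_decompose[of p, symmetric])
      (simp add: poly_prod norm_mult prod_norm[symmetric] norm_power)
  have "cmod (z - \<alpha>) \<le> cmod (w - \<alpha>)" if "poly p \<alpha> = 0" for \<alpha>
    using left[OF that] z w by (simp add: cmod_def power_mono)
  then have "cmod (poly p z) \<le> cmod (poly p w)"
    unfolding eval by (intro mult_left_mono prod_mono conjI power_mono) auto
  with less show False by simp
qed

definition gbinomial_poly :: "nat \<Rightarrow> complex poly" where
  "gbinomial_poly j = smult (1 / fact j) (\<Prod>i<j. [:- of_nat i, 1:])"

lemma poly_gbinomial_poly: "poly (gbinomial_poly j) z = (\<Prod>i<j. z - of_nat i) / fact j"
  by (simp add: gbinomial_poly_def poly_prod)

lemma poly_gbinomial_poly_of_nat: "poly (gbinomial_poly j) (of_nat m) = of_nat (m choose j)"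
  by (simp add: poly_gbinomial_poly binomial_gbinomial gbinomial_prod_rev atLeast0LessThan)

definition ehrhart_coeff :: "nat \<Rightarrow> nat \<Rightarrow> nat" where
  "ehrhart_coeff k j = (2 * k + 1 choose j) * balanced_splits k j"

definition ehrhart_cycle :: "nat \<Rightarrow> complex poly" where
  "ehrhart_cycle k = (\<Sum>j\<le>2 * k. smult (of_nat (ehrhart_coeff k j)) (gbinomial_poly j))"

lemma poly_ehrhart_cycle:
  "poly (ehrhart_cycle k) (of_nat m) = of_nat (card (balanced k (2 * k + 1) m))"
proof -
  have "card (balanced k (2 * k + 1) m)
      = (\<Sum>j\<le>2 * k + 1. ehrhart_coeff k j * (m choose j))"
    by (simp only: card_balanced ehrhart_coeff_def)
  also have "\<dots> = (\<Sum>j\<le>2 * k. ehrhart_coeff k j * (m choose j))"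
    by (simp add: ehrhart_coeff_def balanced_splits_def)
  finally show ?thesis
    by (simp add: ehrhart_cycle_def poly_sum poly_gbinomial_poly_of_nat)
qed

fun coeff_loop :: "int \<Rightarrow> int \<Rightarrow> int \<Rightarrow> int \<Rightarrow> int list \<Rightarrow> int list \<Rightarrow> int list" where
  "coeff_loop k b t h cs [] = cs"
| "coeff_loop k b t h cs (j # js) =
     coeff_loop k (b * (2 * k + 2 - j) div j) (2 * t - 2 * h)
       (if j < k then 0 else if j = k then 1 else h * j div (j - k)) (b * t # cs) js"

text \<open>
  The three accumulators \<open>b\<close>, \<open>t\<close>, \<open>h\<close> of the loop are \<open>2 * k + 1 choose i\<close>,
  \<open>balanced_splits k i\<close> and \<open>i choose k\<close>, updated by their first-order recurrences. The
  coefficients come out in descending order, as Horner's scheme needs them.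
\<close>

lemma coeff_loop_eq:
  assumes "i + n \<le> 2 * k + 1"
  shows "coeff_loop (int k) (int (2 * k + 1 choose i)) (int (balanced_splits k i)) (int (i choose k))
      cs [int i + 1..int (i + n)] = rev (map (int \<circ> ehrhart_coeff k) [i..<i + n]) @ cs"
  using assms
proof (induction n arbitrary: i cs)
  case (Suc n)
  have "(i + 1) * (2 * k + 1 choose (i + 1)) = (2 * k + 1 - i) * (2 * k + 1 choose i)"
    using binomial_absorption[of i "2 * k + 1"] binomial_absorb_comp[of "2 * k + 1" i]
    by (simp del: binomial_Suc_Suc)
  then have "int (i + 1) * int (2 * k + 1 choose (i + 1)) = int (2 * k + 1 - i) * int (2 * k + 1 choose i)"
    by (simp only: flip: of_nat_mult)
  moreover have "int (2 * k + 1 - i) = 2 * int k + 2 - (int i + 1)"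
    using Suc.prems by linarith
  ultimately have "(int i + 1) * int (2 * k + 1 choose (i + 1))
      = int (2 * k + 1 choose i) * (2 * int k + 2 - (int i + 1))"
    by (simp only: of_nat_add of_nat_1 mult.commute)
  then have b: "int (2 * k + 1 choose i) * (2 * int k + 2 - (int i + 1)) div (int i + 1)
      = int (2 * k + 1 choose Suc i)"
    by (metis Suc_eq_plus1 nonzero_mult_div_cancel_left of_nat_Suc of_nat_eq_0_iff nat.distinct(1) add.commute)
  have t: "2 * int (balanced_splits k i) - 2 * int (i choose k) = int (balanced_splits k (Suc i))"
    using balanced_splits_Suc[of i k] Suc.prems by linarith
  have h: "(if int i + 1 < int k then 0 else if int i + 1 = int k then 1
      else int (i choose k) * (int i + 1) div (int i + 1 - int k)) = int (Suc i choose k)"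
  proof (cases "Suc i \<le> k")
    case False
    then have "(Suc i - k) * (Suc i choose k) = Suc i * (i choose k)"
      using binomial_absorb_comp[of "Suc i" k] by (simp del: binomial_Suc_Suc)
    then have "int (Suc i - k) * int (Suc i choose k) = int (Suc i) * int (i choose k)"
      by (simp only: flip: of_nat_mult)
    moreover have "int (Suc i - k) = int i + 1 - int k" "int (Suc i) = int i + 1"
      using False by linarith+
    ultimately have "(int i + 1 - int k) * int (Suc i choose k) = int (i choose k) * (int i + 1)"
      by (simp only: mult.commute)
    then have "int (i choose k) * (int i + 1) div (int i + 1 - int k) = int (Suc i choose k)"
      using False by (metis nonzero_mult_div_cancel_left add.commute diff_gt_0_iff_gt less_irrefl not_le of_nat_Suc of_nat_less_iff)
    then show ?thesis using False by auto
  next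
    case True
    then consider "Suc i < k" | "k = Suc i" by linarith
    then show ?thesis by cases auto
  qed
  have "[int i + 1..int (i + Suc n)] = (int i + 1) # [int (Suc i) + 1..int (Suc i + n)]"
    by (subst upto_rec1) (auto simp: algebra_simps)
  then have "coeff_loop (int k) (int (2 * k + 1 choose i)) (int (balanced_splits k i)) (int (i choose k))
      cs [int i + 1..int (i + Suc n)]
    = coeff_loop (int k) (int (2 * k + 1 choose Suc i)) (int (balanced_splits k (Suc i)))
        (int (Suc i choose k)) (int (ehrhart_coeff k i) # cs) [int (Suc i) + 1..int (Suc i + n)]"
    by (simp only: coeff_loop.simps b t h) (simp only: ehrhart_coeff_def of_nat_mult)
  also have "\<dots> = rev (map (int \<circ> ehrhart_coeff k) [Suc i..<Suc i + n]) @ int (ehrhart_coeff k i) # cs"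
    using Suc.prems by (intro Suc.IH) simp
  also have "\<dots> = rev (map (int \<circ> ehrhart_coeff k) [i..<i + Suc n]) @ cs"
    by (simp add: upt_conv_Cons del: upt_Suc)
  finally show ?case .
qed simp

text \<open>
  Multiplies the coefficient of \<open>z gchoose j\<close> by \<open>n! / j!\<close>, where \<open>n\<close> is the largest index, so that
  Horner's scheme for the basis \<open>z gchoose j\<close> runs without divisions. It is kept separate from
  \<open>horner\<close> because its result is shared by the evaluations at two points.
\<close>

fun clear_fact :: "int \<Rightarrow> int \<Rightarrow> int list \<Rightarrow> int list" where
  "clear_fact K j [] = []"
| "clear_fact K j (c # cs) = c * K # clear_fact (j * K) (j - 1) cs"

text \<open>
  Horner's scheme at \<open>z = (x + \<i> y) / s\<close> on Gaussian integers: the accumulator \<open>r + \<i> i\<close> is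
  multiplied by \<open>s z - s j\<close> for descending \<open>j\<close>, and \<open>p\<close> is the power of \<open>s\<close> that the next
  coefficient needs to match this scaling.
\<close>

fun horner :: "int \<Rightarrow> int \<Rightarrow> int \<Rightarrow> int \<Rightarrow> int \<Rightarrow> int \<Rightarrow> int \<Rightarrow> int list \<Rightarrow> int \<times> int" where
  "horner s x y p j r i [] = (r, i)"
| "horner s x y p j r i (c # cs) =
     horner s x y (s * p) (j - 1) (p * c + ((x - s * j) * r - y * i)) ((x - s * j) * i + y * r) cs"

lemma horner_step:
  fixes z :: complex
  assumes z: "of_int s * z = Complex (of_int x) (of_int y)"
  shows "Complex (of_int (c + ((x - s * j) * r - y * i))) (of_int ((x - s * j) * i + y * r))
      = of_int c + of_int s * (z - of_int j) * Complex (of_int r) (of_int i)"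
proof -
  have "of_int s * (z - of_int j) = Complex (of_int (x - s * j)) (of_int y)"
    by (simp add: right_diff_distrib z complex_eq_iff)
  then show ?thesis by (simp only:) (simp add: complex_eq_iff algebra_simps)
qed

lemma horner_eq:
  fixes z :: complex
  assumes z: "of_int s * z = Complex (of_int x) (of_int y)"
    and res: "horner s x y p (int n) r i (clear_fact K (int n) (rev (map a [0..<Suc n]))) = (r', i')"
  shows "Complex (of_int r') (of_int i') =
    of_int (p * K * s ^ n) * fact n * (\<Sum>j\<le>n. of_int (a j) * poly (gbinomial_poly j) z)
    + of_int s ^ Suc n * (\<Prod>l<Suc n. z - of_nat l) * Complex (of_int r) (of_int i)"
  using res
proof (induction n arbitrary: p K r i)
  case 0
  then show ?case using horner_step[OF z, of "p * (a 0 * K)" 0 r i]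
    by (simp add: poly_gbinomial_poly)
next
  case (Suc n)
  let ?G = "Complex (of_int r) (of_int i)"
  have "horner s x y (s * p) (int n) (p * (a (Suc n) * K) + ((x - s * int (Suc n)) * r - y * i))
      ((x - s * int (Suc n)) * i + y * r)
      (clear_fact (int (Suc n) * K) (int n) (rev (map a [0..<Suc n]))) = (r', i')"
    using Suc.prems by simp
  from Suc.IH[OF this, unfolded horner_step[OF z]]
  have "Complex (of_int r') (of_int i') =
    of_int (s * p * (int (Suc n) * K) * s ^ n) * fact n * (\<Sum>j\<le>n. of_int (a j) * poly (gbinomial_poly j) z)
    + of_int s ^ Suc n * (\<Prod>l<Suc n. z - of_nat l) *
      (of_int (p * (a (Suc n) * K)) + of_int s * (z - of_int (int (Suc n))) * ?G)" .
  also have "of_int s ^ Suc n * (\<Prod>l<Suc n. z - of_nat l) *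
      (of_int (p * (a (Suc n) * K)) + of_int s * (z - of_int (int (Suc n))) * ?G)
    = of_int (p * K * s ^ Suc n) * fact (Suc n) * (of_int (a (Suc n)) * poly (gbinomial_poly (Suc n)) z)
      + of_int s ^ Suc (Suc n) * (\<Prod>l<Suc (Suc n). z - of_nat l) * ?G"
  proof -
    have "(\<Prod>l<Suc n. z - of_nat l) = fact (Suc n) * poly (gbinomial_poly (Suc n)) z"
      by (simp only: poly_gbinomial_poly) (simp del: fact_Suc prod.lessThan_Suc)
    then show ?thesis
      unfolding prod.lessThan_Suc[of _ "Suc n"]
      by (simp only: of_int_mult of_int_power of_int_of_nat_eq power_Suc) (simp only: algebra_simps)
  qed
  also have "of_int (s * p * (int (Suc n) * K) * s ^ n) * fact n = (of_int (p * K * s ^ Suc n) * fact (Suc n) :: complex)"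
    by (simp add: algebra_simps)
  finally show ?case by (simp only: sum.atMost_Suc) (simp only: algebra_simps)
qed

lemma horner_ehrhart_cycle:
  assumes k: "0 < k" and z: "of_int s * z = Complex (of_int x) (of_int y)"
    and res: "horner s x y 1 (2 * int k) 0 0
      (clear_fact 1 (2 * int k) (coeff_loop (int k) 1 1 0 [] [1..2 * int k + 1])) = (r, i)"
  shows "Complex (of_int r) (of_int i) = of_int (s ^ (2 * k)) * fact (2 * k) * poly (ehrhart_cycle k) z"
proof -
  have "coeff_loop (int k) 1 1 0 [] [1..2 * int k + 1]
      = rev (map (int \<circ> ehrhart_coeff k) [0..<Suc (2 * k)])"
    using coeff_loop_eq[of 0 "2 * k + 1" k "[]"]
    using k by (simp add: balanced_splits_0 binomial_eq_0 add.commute)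
  with res have "horner s x y 1 (int (2 * k)) 0 0
      (clear_fact 1 (int (2 * k)) (rev (map (int \<circ> ehrhart_coeff k) [0..<Suc (2 * k)]))) = (r, i)"
    by (simp only: of_nat_mult of_nat_numeral)
  from horner_eq[OF z this] show ?thesis
    by (simp add: ehrhart_cycle_def poly_sum Complex_eq_0)
qed

text \<open>
  Comparing \<open>\<bar>r\<bar> + \<bar>i\<bar>\<close> with \<open>N * r'\<close>, instead of the two absolute values, avoids squaring integers of
  more than a thousand bits.
\<close>

definition one_norm_less_Re :: "int \<Rightarrow> int \<times> int \<Rightarrow> int \<times> int \<Rightarrow> bool" where
  "one_norm_less_Re N = (\<lambda>(r, i) (r', i'). \<bar>r\<bar> + \<bar>i\<bar> < N * r')"

text \<open>
  The two points are \<open>126 + 172 \<i>\<close> and \<open>126.5 + 172 \<i>\<close>, next to the root which numerically is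
  \<open>126.5726 + 172.3729 \<i>\<close>. The factor \<open>2 ^ 126\<close> makes up for the denominator \<open>s = 2\<close> of the second
  point, whose value \<open>horner\<close> scales by \<open>s ^ 126\<close>. The comparison holds with a margin of about five
  per cent.
\<close>

definition horner_values_drop :: "int list \<Rightarrow> bool" where
  "horner_values_drop cs = one_norm_less_Re (2 ^ 126) (horner 2 253 344 1 126 0 0 cs) (horner 1 126 172 1 126 0 0 cs)"

lemma horner_values_drop_127: "horner_values_drop (clear_fact 1 126 (coeff_loop 63 1 1 0 [] [1..127]))"
  by code_simp

lemma ehrhart_cycle_root: "\<exists>\<alpha>. poly (ehrhart_cycle 63) \<alpha> = 0 \<and> 126 < Re \<alpha>"
proof -
  define cs where "cs = clear_fact 1 126 (coeff_loop 63 1 1 0 [] [1..127])"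
  obtain r i where w: "horner 2 253 344 1 126 0 0 cs = (r, i)" by fastforce
  obtain r' i' where z: "horner 1 126 172 1 126 0 0 cs = (r', i')" by fastforce
  have less: "\<bar>r\<bar> + \<bar>i\<bar> < 2 ^ 126 * r'"
    using horner_values_drop_127 w z by (simp add: horner_values_drop_def one_norm_less_Re_def cs_def)
  let ?L = "poly (ehrhart_cycle 63)" and ?w = "Complex (253 / 2) 172" and ?z = "Complex 126 172"
  have w': "Complex (of_int r) (of_int i) = 2 ^ 126 * fact 126 * ?L ?w"
    using horner_ehrhart_cycle[of 63 2 ?w 253 344 r i] w by (simp add: cs_def complex_eq_iff)
  have z': "Complex (of_int r') (of_int i') = fact 126 * ?L ?z"
    using horner_ehrhart_cycle[of 63 1 ?z 126 172 r' i'] z by (simp add: cs_def)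
  have "2 ^ 126 * fact 126 * cmod (?L ?w) = cmod (Complex (of_int r) (of_int i))"
    unfolding w' by (simp add: norm_mult norm_power)
  also have "\<dots> \<le> \<bar>of_int r\<bar> + \<bar>of_int i\<bar>"
    using cmod_le[of "Complex (of_int r) (of_int i)"] by simp
  also have "\<dots> < 2 ^ 126 * of_int r'"
    using less by (simp flip: of_int_abs of_int_add of_int_less_iff[where 'a = real])
  also have "\<dots> \<le> 2 ^ 126 * cmod (Complex (of_int r') (of_int i'))"
    using complex_Re_le_cmod[of "Complex (of_int r') (of_int i')"] by simp
  also have "\<dots> = 2 ^ 126 * fact 126 * cmod (?L ?z)"
    unfolding z' by (simp add: norm_mult)
  finally have "cmod (?L ?w) < cmod (?L ?z)"
    by simp
  then show ?thesis
    by (intro exists_root_Re_greater[of _ ?z ?w]) auto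
qed

section \<open>Symmetric edge polytopes of odd cycles\<close>

text \<open>
  The edge vectors of the cycle, indexed from \<open>0\<close>; the last one returns to the first vertex.
\<close>

definition edge :: "nat \<Rightarrow> nat \<Rightarrow> real^'n::enum" where
  "edge d i = e (i + 1) - e (if i + 1 < d then i + 2 else 1)"

lemma coord_eq_iff:
  assumes "CARD('n::enum) = d + 1" "1 \<le> i" "i \<le> d + 1" "1 \<le> j" "j \<le> d + 1"
  shows "(coord i :: 'n) = coord j \<longleftrightarrow> i = j"
proof -
  have "length (Enum.enum :: 'n list) = d + 1"
    using assms(1) by (metis card_UNIV_length_enum)
  then have "(coord i :: 'n) = coord j \<longleftrightarrow> i - 1 = j - 1"
    unfolding coord_def using assms by (intro nth_eq_iff_index_eq enum_distinct) auto
  then show ?thesis using assms by auto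
qed

lemma coord_surj:
  assumes "CARD('n::enum) = d + 1"
  obtains i where "1 \<le> i" "i \<le> d + 1" "(x :: 'n) = coord i"
proof -
  have "length (Enum.enum :: 'n list) = d + 1"
    using assms(1) by (metis card_UNIV_length_enum)
  moreover have "x \<in> set Enum.enum" by (simp add: enum_UNIV)
  ultimately obtain l where "l < d + 1" "x = Enum.enum ! l" by (metis in_set_conv_nth)
  then show ?thesis by (intro that[of "l + 1"]) (auto simp: coord_def)
qed

lemma e_nth:
  assumes "CARD('n::enum) = d + 1" "1 \<le> i" "i \<le> d + 1" "1 \<le> j" "j \<le> d + 1"
  shows "(e i :: (real, 'n) vec) $ coord j = (if i = j then 1 else 0)"
  using coord_eq_iff[OF assms] by (simp add: e_def axis_def eq_commute[of "coord j"])

context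
  fixes d k :: nat
  assumes card: "CARD('n::enum) = d + 1" and d: "d = 2 * k + 1" and k: "0 < k"
begin

lemma edge_nth:
  assumes "i < d" "1 \<le> j" "j \<le> d + 1"
  shows "(edge d i :: (real, 'n) vec) $ coord j =
    (if j = i + 1 then 1 else 0) - (if j = (if i + 1 < d then i + 2 else 1) then 1 else 0)"
  using assms d k by (auto simp: edge_def e_nth[OF card])

lemma edge_comb_nth_last: "(\<Sum>i<d. c i *\<^sub>R (edge d i :: (real, 'n) vec)) $ coord (d + 1) = 0"
proof -
  have "(\<Sum>i<d. c i *\<^sub>R (edge d i :: (real, 'n) vec)) $ coord (d + 1)
      = (\<Sum>i<d. c i * (edge d i :: (real, 'n) vec) $ coord (d + 1))" by simp
  also have "\<dots> = 0"
  proof (intro sum.neutral ballI)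
    fix i assume "i \<in> {..<d}"
    then show "c i * (edge d i :: (real, 'n) vec) $ coord (d + 1) = 0"
      using edge_nth[of i "d + 1"] by simp
  qed
  finally show ?thesis .
qed

lemma edge_comb_nth:
  assumes "j < d"
  shows "(\<Sum>i<d. c i *\<^sub>R (edge d i :: (real, 'n) vec)) $ coord (j + 1) = c j - c (if j = 0 then d - 1 else j - 1)"
proof -
  let ?p = "if j = 0 then d - 1 else j - 1"
  have "(\<Sum>i<d. c i *\<^sub>R (edge d i :: (real, 'n) vec)) $ coord (j + 1)
      = (\<Sum>i<d. c i * (edge d i :: (real, 'n) vec) $ coord (j + 1))" by simp
  also have "\<dots> = (\<Sum>i<d. (if i = j then c i else 0) - (if i = ?p then c i else 0))"
  proof (intro sum.cong refl)
    fix i assume "i \<in> {..<d}"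
    then have i: "i < d" by simp
    have "j + 1 = (if i + 1 < d then i + 2 else 1) \<longleftrightarrow> i = ?p"
      using i assms by auto
    then show "c i * (edge d i :: (real, 'n) vec) $ coord (j + 1)
        = (if i = j then c i else 0) - (if i = ?p then c i else 0)"
      using edge_nth[of i "j + 1"] i assms by auto
  qed
  also have "\<dots> = c j - c ?p"
  proof -
    have "?p < d" using assms by auto
    then show ?thesis using assms by (simp only: sum_subtractf sum.delta' finite_lessThan sum.delta lessThan_iff if_True)
  qed
  finally show ?thesis .
qed

lemma vec_eqI:
  fixes x y :: "(real, 'n) vec"
  assumes "x $ coord (d + 1) = y $ coord (d + 1)" "\<And>j. j < d \<Longrightarrow> x $ coord (j + 1) = y $ coord (j + 1)"
  shows "x = y"
proof (unfold vec_eq_iff, rule allI)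
  fix l :: 'n
  obtain i where i: "1 \<le> i" "i \<le> d + 1" "l = coord i" using coord_surj[OF card] .
  show "x $ l = y $ l"
  proof (cases "i = d + 1")
    case False
    then show ?thesis using assms(2)[of "i - 1"] i by auto
  qed (use i assms in auto)
qed

text \<open>
  A vanishing combination has equal consecutive coefficients by \<open>edge_comb_nth\<close>.
\<close>

lemma odd_circuit_edge: "odd_circuit d k (edge d :: nat \<Rightarrow> (real, 'n) vec)"
proof
  have "(\<Sum>i<d. (1 :: real) *\<^sub>R (edge d i :: (real, 'n) vec)) = 0"
    by (rule vec_eqI) (simp_all only: edge_comb_nth edge_comb_nth_last, simp_all)
  then show "(\<Sum>i<d. edge d i :: (real, 'n) vec) = 0" by simp
next
  fix c :: "nat \<Rightarrow> real" and i j
  assume 0: "(\<Sum>l<d. c l *\<^sub>R (edge d l :: (real, 'n) vec)) = 0" and ij: "i < d" "j < d"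
  have const: "c l = c 0" if "l < d" for l
    using that
  proof (induction l)
    case (Suc l)
    then have "c (Suc l) - c l = 0"
      using edge_comb_nth[of "Suc l" c] 0 by simp
    then show ?case using Suc by simp
  qed simp
  show "c i = c j" using const[OF ij(1)] const[OF ij(2)] by (rule trans[OF _ sym])
qed (use d in auto)

interpretation odd_circuit d k "edge d :: nat \<Rightarrow> (real, 'n) vec"
  by (rule odd_circuit_edge)

lemma sum_coord_edge_comb:
  "(\<Sum>i = 1..d. (\<Sum>l<d. c l *\<^sub>R (edge d l :: (real, 'n) vec)) $ coord i) = 0"
proof -
  have "(\<Sum>i = 1..d. (\<Sum>l<d. c l *\<^sub>R (edge d l :: (real, 'n) vec)) $ coord i)
      = (\<Sum>l<d. c l * (\<Sum>i = 1..d. (edge d l :: (real, 'n) vec) $ coord i))"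
    by (simp add: sum_distrib_left) (rule sum.swap)
  also have "\<dots> = 0"
  proof (intro sum.neutral ballI)
    fix l assume "l \<in> {..<d}"
    then have l: "l < d" by simp
    have "(\<Sum>i = 1..d. (edge d l :: (real, 'n) vec) $ coord i)
      = (\<Sum>i = 1..d. (if i = l + 1 then 1 else 0) - (if i = (if l + 1 < d then l + 2 else 1) then 1 else 0))"
      using l by (intro sum.cong) (auto simp: edge_nth)
    also have "\<dots> = 0"
      using l by (simp add: sum_subtractf)
    finally show "c l * (\<Sum>i = 1..d. (edge d l :: (real, 'n) vec) $ coord i) = 0" by simp
  qed
  finally show ?thesis .
qed

text \<open>
  The coordinate \<open>j\<close> of a combination of edge vectors is the difference of two consecutive
  coefficients, so prefix sums of the coordinates are possible coefficients.
\<close>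

lemma edge_comb_prefix_sums:
  fixes x :: "(real, 'n) vec"
  assumes "x $ coord (d + 1) = 0" "(\<Sum>i = 1..d. x $ coord i) = 0"
  shows "x = (\<Sum>i<d. (\<Sum>l\<le>i. x $ coord (l + 1)) *\<^sub>R edge d i)"
proof (rule vec_eqI)
  show "x $ coord (d + 1) = (\<Sum>i<d. (\<Sum>l\<le>i. x $ coord (l + 1)) *\<^sub>R (edge d i :: (real, 'n) vec)) $ coord (d + 1)"
    by (rule trans[OF assms(1) edge_comb_nth_last[symmetric]])
next
  fix j assume j: "j < d"
  have "(\<Sum>l\<le>d - 1. x $ coord (l + 1)) = (\<Sum>i = 1..d. x $ coord i)"
    using d by (intro sum.reindex_bij_witness[of _ "\<lambda>i. i - 1" "\<lambda>l. l + 1"]) auto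
  then have "(\<Sum>l\<le>d - 1. x $ coord (l + 1)) = 0" using assms(2) by simp
  then show "x $ coord (j + 1) = (\<Sum>i<d. (\<Sum>l\<le>i. x $ coord (l + 1)) *\<^sub>R (edge d i :: (real, 'n) vec)) $ coord (j + 1)"
    unfolding edge_comb_nth[OF j] by (cases j) auto
qed

lemma sum_zero_lattice_eq: "(sum_zero_lattice d :: ((real, 'n) vec) set) = lat"
proof (intro equalityI subsetI)
  fix x :: "(real, 'n) vec" assume x: "x \<in> sum_zero_lattice d"
  then have "\<forall>i. \<exists>c :: int. x $ i = of_int c"
    by (auto simp: sum_zero_lattice_def int_lattice_def elim!: Ints_cases)
  then obtain c :: "'n \<Rightarrow> int" where c: "\<And>i. x $ i = of_int (c i)" by metis
  have "x = (\<Sum>i<d. (\<Sum>l\<le>i. x $ coord (l + 1)) *\<^sub>R edge d i)"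
    using x by (intro edge_comb_prefix_sums) (auto simp: sum_zero_lattice_def)
  also have "\<dots> = (\<Sum>i<d. of_int (\<Sum>l\<le>i. c (coord (l + 1))) *\<^sub>R edge d i)"
    by (simp add: c)
  finally show "x \<in> lat" using latI by metis
next
  fix x :: "(real, 'n) vec" assume "x \<in> lat"
  then obtain c :: "nat \<Rightarrow> int" where x: "x = (\<Sum>i<d. of_int (c i) *\<^sub>R edge d i)"
    by (auto simp: lat_def)
  have "edge d i $ l \<in> \<int>" for i and l :: 'n
    by (auto simp: edge_def e_def axis_def)
  then have "x \<in> int_lattice"
    by (auto simp: x int_lattice_def intro!: Ints_sum Ints_mult)
  then show "x \<in> sum_zero_lattice d"
    using edge_comb_nth_last[of "\<lambda>i. of_int (c i)"] sum_coord_edge_comb[of "\<lambda>i. of_int (c i)"]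
    by (simp only: sum_zero_lattice_def mem_Collect_eq x)
qed

text \<open>
  This identifies lattice points of \<open>int_lattice\<close> in the dilates, which the Ehrhart polynomial counts,
  with points of \<open>lat\<close>.
\<close>

lemma span_lat_Int_int_lattice: "span lat \<inter> int_lattice = lat"
proof -
  have "x \<in> sum_zero_lattice d" if x: "x \<in> span lat" "x \<in> int_lattice" for x :: "(real, 'n) vec"
  proof -
    obtain r where "x = (\<Sum>i<d. r i *\<^sub>R edge d i)" using x(1) unfolding span_lat_eq by blast
    then show ?thesis
      using x(2) edge_comb_nth_last[of r] sum_coord_edge_comb[of r]
      by (simp only: sum_zero_lattice_def mem_Collect_eq)
  qed
  moreover have "lat \<subseteq> int_lattice"
    by (auto simp: sum_zero_lattice_eq[symmetric] sum_zero_lattice_def)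
  ultimately show ?thesis
    using span_superset by (auto simp: sum_zero_lattice_eq)
qed

lemma edges_eq:
  "edge d ` {..<d} = insert (e d - e 1 :: (real, 'n) vec) ((\<lambda>i. e i - e (i + 1)) ` {1..<d})"
proof -
  have "{..<d} = insert (d - 1) ((\<lambda>i. i - 1) ` {1..<d})"
  proof (intro equalityI subsetI)
    fix i assume "i \<in> {..<d}"
    then consider "i = d - 1" | "i + 1 \<in> {1..<d}" by fastforce
    then show "i \<in> insert (d - 1) ((\<lambda>i. i - 1) ` {1..<d})"
      by cases (auto intro: image_eqI[of _ _ "i + 1"])
  qed (use d in auto)
  then have "edge d ` {..<d} = insert (edge d (d - 1) :: (real, 'n) vec) ((\<lambda>i. edge d (i - 1)) ` {1..<d})"
    by (metis image_image image_insert)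
  moreover have "edge d (d - 1) = (e d - e 1 :: (real, 'n) vec)"
    using d by (simp add: edge_def)
  moreover have "(\<lambda>i. edge d (i - 1) :: (real, 'n) vec) ` {1..<d} = (\<lambda>i. e i - e (i + 1)) ` {1..<d}"
    by (intro image_cong) (auto simp: edge_def)
  ultimately show ?thesis by simp
qed

lemma set_A_columns: "set (A_columns d :: (real, 'n) vec list) = (\<lambda>v. e (d + 1) + v) ` gens"
proof -
  have "gens = insert 0 (edge d ` {..<d} \<union> uminus ` edge d ` {..<d} :: (real, 'n) vec set)"
    by (simp add: gens_def image_image)
  then show ?thesis
    unfolding edges_eq by (auto simp: A_columns_def image_Un image_image algebra_simps)
qed

lemma conv_A_eq: "conv_A d = (\<lambda>v. e (d + 1) + v) ` (body :: (real, 'n) vec set)"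
  unfolding conv_A_def set_A_columns body_def by (rule convex_hull_translation)

lemma conv_A_centered_eq: "(conv_A_centered d :: (real, 'n) vec set) = body"
  by (simp add: conv_A_centered_def conv_A_eq image_image)

lemma e_in_int_lattice: "(e i :: (real, 'n) vec) \<in> int_lattice"
  by (auto simp: int_lattice_def e_def axis_def)

lemma ehrhart_conv_A_centered: "is_ehrhart_poly (conv_A_centered d :: ((real, 'n) vec) set) (ehrhart_cycle k)"
  unfolding is_ehrhart_poly_def conv_A_centered_eq
proof (intro allI impI)
  fix m :: nat assume m: "1 \<le> m"
  have "(\<lambda>x. real m *\<^sub>R x) ` body \<subseteq> span lat"
    using span_body span_superset by (auto intro!: span_scale)
  then have "(\<lambda>x. real m *\<^sub>R x) ` body \<inter> int_lattice = (\<lambda>x. real m *\<^sub>R x) ` body \<inter> lat"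
    using span_lat_Int_int_lattice by blast
  then show "poly (ehrhart_cycle k) (of_nat m)
      = of_nat (card ((\<lambda>x. real m *\<^sub>R x) ` body \<inter> int_lattice))"
    using card_dilated_body[OF m] d by (simp add: poly_ehrhart_cycle)
qed

lemma ehrhart_conv_A: "is_ehrhart_poly (conv_A d :: ((real, 'n) vec) set) (ehrhart_cycle k)"
  unfolding is_ehrhart_poly_def
proof (intro allI impI)
  fix m :: nat assume m: "1 \<le> m"
  let ?t = "real m *\<^sub>R (e (d + 1) :: (real, 'n) vec)"
  have t: "?t \<in> int_lattice"
    using e_in_int_lattice[of "d + 1"] by (auto simp: int_lattice_def)
  have "bij_betw (\<lambda>x. ?t + x) ((\<lambda>x. real m *\<^sub>R x) ` body \<inter> int_lattice)
      ((\<lambda>x. real m *\<^sub>R x) ` conv_A d \<inter> int_lattice)"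
  proof (rule bij_betwI[where g = "\<lambda>x. x - ?t"])
    show "(\<lambda>x. ?t + x) \<in> (\<lambda>x. real m *\<^sub>R x) ` body \<inter> int_lattice
        \<rightarrow> (\<lambda>x. real m *\<^sub>R x) ` conv_A d \<inter> int_lattice"
      using t unfolding conv_A_eq by (auto simp: int_lattice_def scaleR_right_distrib image_image)
    show "(\<lambda>x. x - ?t) \<in> (\<lambda>x. real m *\<^sub>R x) ` conv_A d \<inter> int_lattice
        \<rightarrow> (\<lambda>x. real m *\<^sub>R x) ` body \<inter> int_lattice"
      using t unfolding conv_A_eq by (auto simp: int_lattice_def scaleR_right_distrib image_image)
  qed auto
  then have "card ((\<lambda>x. real m *\<^sub>R x) ` body \<inter> int_lattice)
      = card ((\<lambda>x. real m *\<^sub>R x) ` (conv_A d :: ((real, 'n) vec) set) \<inter> int_lattice)"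
    by (rule bij_betw_same_card)
  then show "poly (ehrhart_cycle k) (of_nat m)
      = of_nat (card ((\<lambda>x. real m *\<^sub>R x) ` (conv_A d :: ((real, 'n) vec) set) \<inter> int_lattice))"
    using ehrhart_conv_A_centered m by (simp add: is_ehrhart_poly_def conv_A_centered_eq)
qed

lemma aff_dim_conv_A: "aff_dim (conv_A d :: ((real, 'n) vec) set) = 2 * int k"
  by (simp add: conv_A_eq aff_dim_translation_eq aff_dim_body)

lemma aff_dim_conv_A_centered: "aff_dim (conv_A_centered d :: ((real, 'n) vec) set) = 2 * int k"
  by (simp add: conv_A_centered_eq aff_dim_body)

lemma lattice_polytope_conv_A: "lattice_polytope int_lattice (conv_A d :: ((real, 'n) vec) set)"
proof -
  have "e (d + 1) + v \<in> int_lattice" if "v \<in> gens" for v :: "(real, 'n) vec"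
  proof -
    have "v \<in> int_lattice"
      using that gens_subset_lat span_lat_Int_int_lattice by blast
    then show ?thesis
      using e_in_int_lattice[of "d + 1"] by (simp add: int_lattice_def)
  qed
  then have "(\<lambda>v. e (d + 1) + v) ` (gens :: (real, 'n) vec set) \<subseteq> int_lattice"
    by (rule image_subsetI)
  moreover have "(gens :: (real, 'n) vec set) \<noteq> {}" by (simp add: gens_def)
  ultimately show ?thesis
    unfolding lattice_polytope_def conv_A_def set_A_columns
    using finite_gens by (metis finite_imageI image_is_empty)
qed

lemma smooth_fano_conv_A_centered:
  "smooth_fano (sum_zero_lattice d) (conv_A_centered d :: ((real, 'n) vec) set)"
  by (simp add: sum_zero_lattice_eq conv_A_centered_eq smooth_fano_body)

lemma gorenstein_fano_conv_A_centered:
  "gorenstein_fano (sum_zero_lattice d) (conv_A_centered d :: ((real, 'n) vec) set)"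
  by (simp add: sum_zero_lattice_eq conv_A_centered_eq gorenstein_fano_body)

end

theorem mainTheorem1:
  fixes P Q L :: "(real^128) set"
  assumes "P = conv_A 127"
    and "Q = conv_A_centered 127"
    and "L = sum_zero_lattice 127"
  shows "aff_dim P = 126 \<and>
    (\<exists>p \<alpha>. is_ehrhart_poly P p \<and> poly p \<alpha> = 0 \<and> Re \<alpha> > real_of_int (aff_dim P)) \<and>
    smooth_fano L Q \<and>
    (lattice_polytope int_lattice P \<and>
      \<not> ehrhart_roots_in_strip P (- real_of_int (aff_dim P)) (real_of_int (aff_dim P) - 1)) \<and>
    (gorenstein_fano L Q \<and>
      \<not> ehrhart_roots_in_strip Q (- real_of_int (aff_dim Q) / 2) (real_of_int (aff_dim Q) / 2 - 1))"
proof -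
  have card: "CARD(128) = 127 + 1" and d: "(127 :: nat) = 2 * 63 + 1" and k: "0 < (63 :: nat)"
    by simp_all
  obtain \<alpha> where \<alpha>: "poly (ehrhart_cycle 63) \<alpha> = 0" "126 < Re \<alpha>"
    using ehrhart_cycle_root by blast
  have P: "is_ehrhart_poly P (ehrhart_cycle 63)" "aff_dim P = 126" "lattice_polytope int_lattice P"
    unfolding assms(1) using ehrhart_conv_A[OF card d k] aff_dim_conv_A[OF card d k]
      lattice_polytope_conv_A[OF card d k] by simp_all
  have Q: "is_ehrhart_poly Q (ehrhart_cycle 63)" "aff_dim Q = 126" "smooth_fano L Q" "gorenstein_fano L Q"
    unfolding assms(2,3) using ehrhart_conv_A_centered[OF card d k]
      aff_dim_conv_A_centered[OF card d k] smooth_fano_conv_A_centered[OF card d k]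
      gorenstein_fano_conv_A_centered[OF card d k] by simp_all
  have "\<not> ehrhart_roots_in_strip P a b" if "b \<le> 126" for a b
    using P(1) \<alpha> that unfolding ehrhart_roots_in_strip_def by fastforce
  moreover have "\<not> ehrhart_roots_in_strip Q a b" if "b \<le> 126" for a b
    using Q(1) \<alpha> that unfolding ehrhart_roots_in_strip_def by fastforce
  ultimately show ?thesis
    using P Q \<alpha> by auto
qed

end
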